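(* (1) Let $F$ be a forest, and let $A \in \mathcal{S}(F)$ with $\operatorname{pin}(A) = (r,s)$. Then $(r,s)$ is an elementary inertia of $F$. (2) Conversely, let $G$ be a graph and suppose that for every $A \in \mathcal{S}(G)$, $\operatorname{pin}(A)$ is an elementary inertia of $G$. Then $G$ is a forest.
   Context: All graphs are finite, simple and undirected. For a graph $G=(V,E)$ with vertex set $V=\{1,\ldots,n\}$, $\mathcal{S}(G)$ is the set of all real symmetric $n\times n$ matrices $A=[a_{ij}]$ such that for $i\neq j$, $a_{ij}\neq 0$ if and only if $ij\in E$ (no condition on the diagonal entries). The partial inertia of a Hermitian matrix $A$ is $\operatorname{pin}(A)=(\pi(A),\nu(A))$, where $\pi(A)$ and $\nu(A)$ are the numbers of positive and of negative eigenvalues of $A$, counted with multiplicity. For a graph $G$ on $n$ vertices and $k\in\{0,\ldots,n\}$, the maximal disconnection $\mathrm{MD}_k(G)$ is the maximum, over all induced subgraphs $F$ of $G$ having $n-k$ vertices, of the number of connected components of $F$ (the graph with no vertices has $0$ components). For a graph $G$ on $n$ vertices, an ordered pair $(r,s)$ of integers is an elementary inertia of $G$ if for some integer $k$ with $0\le k\le n$ we have $k\le r$, $k\le s$, and $n-\mathrm{MD}_k(G)+k\le r+s\le n$. *)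

theory Defs
  imports
    "Graph_Theory.Graph_Theory"
    "Jordan_Normal_Form.Char_Poly"
begin

text \<open>
  A finite simple undirected graph is a \<^locale>\<open>pair_graph\<close>: a finite, loop-free digraph whose
  set of arcs is a symmetric set of pairs.  An edge \<open>ij\<close> is represented by its two arcs
  \<open>(i, j)\<close> and \<open>(j, i)\<close>.  The vertices are \<open>0, \<dots>, n - 1\<close>, matching the indices of
  \<open>n \<times> n\<close> matrices.
\<close>

definition graph_on :: "nat \<Rightarrow> nat pair_pre_digraph \<Rightarrow> bool" where
  "graph_on n G \<longleftrightarrow> pair_graph G \<and> pverts G = {0..<n}"

text \<open>
  The library's \<^const>\<open>forest\<close> is about digraphs: there, the two arcs of a single edge already
  form a \<^const>\<open>pre_digraph.cycle\<close> (of length 2).  In an undirected simple graph, cycles have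
  length at least 3.
\<close>

definition undirected_forest :: "'a pair_pre_digraph \<Rightarrow> bool" where
  "undirected_forest G \<longleftrightarrow>
     pair_graph G \<and> \<not> (\<exists>p. pre_digraph.cycle (with_proj G) p \<and> 3 \<le> length p)"

text \<open>
  As the arcs are symmetric, the strongly connected components are the connected components.
  Components have at least one vertex, so the graph with no vertices has none.
\<close>

definition num_components :: "('a, 'b) pre_digraph \<Rightarrow> nat" where
  "num_components H = card (pre_digraph.sccs H)"

definition max_disconnection :: "nat \<Rightarrow> 'a pair_pre_digraph \<Rightarrow> nat" where
  "max_disconnection k G =
     Max {num_components F |F.
       induced_subgraph F (with_proj G) \<and> card (verts F) = card (pverts G) - k}"

definition elementary_inertia :: "'a pair_pre_digraph \<Rightarrow> int \<times> int \<Rightarrow> bool" where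
  "elementary_inertia G = (\<lambda>(r, s). let n = card (pverts G) in
     \<exists>k\<le>n. int k \<le> r \<and> int k \<le> s \<and>
       int n - int (max_disconnection k G) + int k \<le> r + s \<and> r + s \<le> int n)"

definition sym_mats :: "nat pair_pre_digraph \<Rightarrow> real mat set" where
  "sym_mats G = (let n = card (pverts G) in
     {A \<in> carrier_mat n n. transpose_mat A = A \<and>
        (\<forall>i<n. \<forall>j<n. i \<noteq> j \<longrightarrow> (A $$ (i, j) \<noteq> 0 \<longleftrightarrow> (i, j) \<in> parcs G))})"

text \<open>
  The multiplicity of an eigenvalue is its order as a root of the characteristic polynomial.
  The partial inertia is needed for real symmetric matrices only, all of whose eigenvalues
  are real.
\<close>

definition num_pos_eigenvalues :: "real mat \<Rightarrow> nat" where
  "num_pos_eigenvalues A = (\<Sum>x | eigenvalue A x \<and> 0 < x. Polynomial.order x (char_poly A))"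

definition num_neg_eigenvalues :: "real mat \<Rightarrow> nat" where
  "num_neg_eigenvalues A = (\<Sum>x | eigenvalue A x \<and> x < 0. Polynomial.order x (char_poly A))"

definition pin :: "real mat \<Rightarrow> int \<times> int" where
  "pin A = (int (num_pos_eigenvalues A), int (num_neg_eigenvalues A))"

end

theory Submission
  imports Defs "Jordan_Normal_Form.Schur_Decomposition"
begin

text \<open>
  Write \<open>null A\<close> for the nullity of an \<open>n \<times> n\<close> matrix.  An inertia is elementary if and only if
  some set \<open>S\<close> of \<open>k\<close> vertices, with at least \<open>k\<close> positive and \<open>k\<close> negative eigenvalues
  available, leaves at least \<open>null A + k\<close> components when it is removed.

  For a forest such a set is built by stripping off leaves.  An isolated vertex contributes at
  most one to the nullity and is a component by itself.  Let \<open>v\<close> be a leaf with neighbour \<open>u\<close>.  If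
  the diagonal entry at \<open>v\<close> is nonzero, eliminating \<open>v\<close> with this pivot leaves the nullity
  unchanged and yields a matrix for the forest without \<open>v\<close>, as only the diagonal entry at \<open>u\<close>
  changes.  If it is zero, \<open>u\<close> and \<open>v\<close> span a hyperbolic plane that splits off: one positive and one
  negative eigenvalue, the same nullity, and the forest without \<open>u\<close> and \<open>v\<close>.  Then \<open>u\<close> is put into
  \<open>S\<close>, which makes \<open>v\<close> an additional component.  The induction is
  \<open>forest_inertia_certificate\<close>; it carries lower bounds only, namely pairwise orthogonal vectors
  on which the form is positive or negative, and a vertex labelling in place of the components.

  Conversely, let \<open>uw\<close> be an edge of a cycle in a graph with \<open>c\<close> components.  Starting with the
  Laplacian of the graph without \<open>uw\<close>, which is positive semidefinite of nullity \<open>c\<close>, and adding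
  the edge \<open>uw\<close> with the most negative weight for which the form stays semidefinite, one obtains a
  matrix of nullity at least \<open>c + 1\<close> (\<open>non_bridge_psd_matrix\<close>).  It has no negative eigenvalue, so
  only \<open>k = 0\<close> could make its inertia elementary, and this would bound the nullity by \<open>c\<close>.

  Eigenvalue counts are compared with such families of vectors by means of the spectral theorem
  (\<open>real_symmetric_spectral_decomposition\<close>), in the form of one half of Sylvester's law of inertia
  (\<open>positive_family_le_card_positive\<close>) and a bound on the kernel
  (\<open>kernel_family_le_card_zero\<close>).
\<close>

section \<open>The spectral theorem for real symmetric matrices\<close>

lemma symmetric_mat_index:
  assumes "A \<in> carrier_mat n n" "transpose_mat A = A" "i < n" "j < n"
  shows "A $$ (i, j) = A $$ (j, i)"
  using assms by (metis carrier_matD index_transpose_mat(1))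

text \<open>
  Over the complex numbers an eigenvector \<open>v\<close> exists, for an eigenvalue \<open>z\<close>.  The number
  \<open>s = v\<^sup>* A v = z \<parallel>v\<parallel>\<^sup>2\<close> equals its own conjugate by symmetry of \<open>A\<close>, so \<open>z\<close> is real; being
  a root of the real characteristic polynomial, it is an eigenvalue of the real matrix.
\<close>

lemma real_symmetric_eigenvalue_exists:
  fixes A :: "real mat"
  assumes A: "A \<in> carrier_mat n n" and sym: "transpose_mat A = A" and n: "n \<noteq> 0"
  obtains e where "eigenvalue A e"
proof -
  define C where "C = map_mat complex_of_real A"
  have C: "C \<in> carrier_mat n n" using A by (simp add: C_def)
  obtain as where as: "char_poly C = (\<Prod>a\<leftarrow>as. [:- a, 1:])" "length as = n"
    using char_poly_factorized[OF C] by blast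
  then obtain z bs where "as = z # bs" using n by (cases as) auto
  hence root: "poly (char_poly C) z = 0" using as by simp
  hence "eigenvalue C z" using eigenvalue_root_char_poly[OF C] by blast
  then obtain v where v: "v \<in> carrier_vec n" "v \<noteq> 0\<^sub>v n" "C *\<^sub>v v = z \<cdot>\<^sub>v v"
    using C unfolding eigenvalue_def eigenvector_def by auto
  note a = symmetric_mat_index[OF A sym]
  define s where "s = (\<Sum>i<n. \<Sum>j<n. complex_of_real (A $$ (i, j)) * v $ j * cnj (v $ i))"
  define N where "N = (\<Sum>i<n. (cmod (v $ i))\<^sup>2)"
  have "cnj s = (\<Sum>i<n. \<Sum>j<n. complex_of_real (A $$ (i, j)) * cnj (v $ j) * v $ i)"
    by (simp add: s_def)
  also have "\<dots> = (\<Sum>j<n. \<Sum>i<n. complex_of_real (A $$ (i, j)) * cnj (v $ j) * v $ i)"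
    by (rule sum.swap)
  also have "\<dots> = s"
    unfolding s_def by (intro sum.cong refl) (simp add: a)
  finally have real_s: "cnj s = s" .
  have "(\<Sum>j<n. complex_of_real (A $$ (i, j)) * v $ j) = z * v $ i" if "i < n" for i
  proof -
    have "(C *\<^sub>v v) $ i = (\<Sum>j<n. complex_of_real (A $$ (i, j)) * v $ j)"
      using that A v(1) C by (auto simp: C_def scalar_prod_def atLeast0LessThan)
    thus ?thesis using v that by simp
  qed
  hence "s = (\<Sum>i<n. z * v $ i * cnj (v $ i))"
    unfolding s_def by (intro sum.cong refl) (simp flip: sum_distrib_right)
  also have "\<dots> = z * of_real N"
    by (simp add: N_def sum_distrib_left mult.assoc complex_norm_square del: of_real_power)
  finally have s: "s = z * of_real N" .
  obtain i where "i < n" "v $ i \<noteq> 0" using v(1,2) by (metis carrier_vecD eq_vecI index_zero_vec)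
  hence "N > 0" unfolding N_def by (intro sum_pos2[of _ i]) auto
  hence "cnj z = z" using real_s unfolding s by auto
  then obtain e where e: "z = of_real e" by (metis Reals_cnj_iff Reals_cases)
  have "poly (char_poly A) e = 0"
    using root unfolding e C_def of_real_hom.char_poly_hom[OF A] by simp
  hence "eigenvalue A e" using eigenvalue_root_char_poly[OF A] by blast
  thus ?thesis by (rule that)
qed

text \<open>
  The Gram-Schmidt process of the library yields pairwise orthogonal columns that start with
  \<open>v\<close>; dividing each of them by its norm turns the inverse into the transpose.
\<close>

lemma orthogonal_matrix_with_first_column:
  fixes v :: "real vec"
  assumes v: "v \<in> carrier_vec n" "v \<noteq> 0\<^sub>v n"
  obtains W c where "W \<in> carrier_mat n n" "transpose_mat W * W = 1\<^sub>m n" "col W 0 = c \<cdot>\<^sub>v v"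
proof -
  interpret cof_vec_space n "TYPE(real)" .
  define b where "b = basis_completion v"
  define ws where "ws = gram_schmidt n b"
  have n: "n \<noteq> 0" using v by (metis carrier_vecD eq_vecI index_zero_vec(2) not_less_zero)
  have b: "span (set b) = carrier_vec n" "distinct b" "\<not> lin_dep (set b)"
      "set b \<subseteq> carrier_vec n" "hd b = v" "length b = n"
    using basis_completion[OF v, folded b_def] by auto
  then obtain vs where bv: "b = v # vs" using n by (cases b) auto
  have ws: "set ws \<subseteq> carrier_vec n" "corthogonal ws" "length ws = n"
    using gram_schmidt_result[OF b(4,2,3) refl, folded ws_def] b(6) by auto
  have hd: "ws ! 0 = v"
    using gram_schmidt_hd[OF v(1), of vs, folded bv] ws(3) n unfolding ws_def
    by (metis hd_conv_nth length_0_conv)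
  have wsi: "ws ! i \<in> carrier_vec n" if "i < n" for i
    using ws that by (metis nth_mem subsetD)
  have pos: "ws ! i \<bullet> ws ! i > 0" if "i < n" for i
  proof -
    have "ws ! i \<bullet> ws ! i \<noteq> 0"
      using corthogonalD[OF ws(2), of i i] that ws(3) by simp
    moreover have "ws ! i \<bullet> ws ! i \<ge> 0"
      unfolding scalar_prod_def by (intro sum_nonneg) simp
    ultimately show ?thesis by simp
  qed
  have orth: "ws ! i \<bullet> ws ! j = 0" if "i < n" "j < n" "i \<noteq> j" for i j
    using corthogonalD[OF ws(2), of i j] that ws(3) by simp
  define f where "f i = 1 / sqrt (ws ! i \<bullet> ws ! i)" for i
  define W where "W = mat_of_cols n (map (\<lambda>i. f i \<cdot>\<^sub>v ws ! i) [0..<n])"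
  have W: "W \<in> carrier_mat n n"
    using mat_of_cols_carrier(1)[of n "map (\<lambda>i. f i \<cdot>\<^sub>v ws ! i) [0..<n]"] by (simp add: W_def)
  have col: "col W i = f i \<cdot>\<^sub>v ws ! i" if "i < n" for i
    unfolding W_def using that wsi[OF that] by (subst col_mat_of_cols) auto
  have "transpose_mat W * W = 1\<^sub>m n"
  proof (rule eq_matI)
    fix i j assume "i < dim_row (1\<^sub>m n :: real mat)" "j < dim_col (1\<^sub>m n :: real mat)"
    hence ij: "i < n" "j < n" by auto
    have "(transpose_mat W * W) $$ (i, j) = col W i \<bullet> col W j" using ij W by simp
    also have "\<dots> = f i * f j * (ws ! i \<bullet> ws ! j)"
      using col[OF ij(1)] col[OF ij(2)] wsi[OF ij(1)] wsi[OF ij(2)]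
      by simp
    also have "\<dots> = 1\<^sub>m n $$ (i, j)"
      using ij orth[OF ij] pos[OF ij(1)]
      by (cases "i = j") (auto simp: f_def)
    finally show "(transpose_mat W * W) $$ (i, j) = 1\<^sub>m n $$ (i, j)" .
  qed (use W in auto)
  thus ?thesis using that[OF W] col[of 0] n hd by auto
qed

lemma transpose_congruence:
  fixes A :: "'a :: comm_semiring_0 mat"
  assumes "A \<in> carrier_mat n n" "W \<in> carrier_mat n n" "transpose_mat A = A"
  shows "transpose_mat (transpose_mat W * A * W) = transpose_mat W * A * W"
  using assms
  by (simp add: transpose_mult[of _ n n _ n] assoc_mult_mat[of _ n n _ n _ n])

text \<open>
  Deflation: in an orthonormal basis that starts with an eigenvector, the first column of \<open>A\<close> is
  a multiple of the first unit vector, and by symmetry so is the first row.  What remains is a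
  symmetric matrix of size one less.
\<close>

lemma real_symmetric_diagonalization:
  fixes A :: "real mat"
  assumes "A \<in> carrier_mat n n" "transpose_mat A = A"
  shows "\<exists>U D. U \<in> carrier_mat n n \<and> D \<in> carrier_mat n n \<and> transpose_mat U * U = 1\<^sub>m n \<and>
           diagonal_mat D \<and> transpose_mat U * A * U = D"
  using assms
proof (induction n arbitrary: A)
  case 0
  show ?case
    by (intro exI[of _ "1\<^sub>m 0"] exI[of _ A] conjI) (use 0 in \<open>auto simp: diagonal_mat_def\<close>)
next
  case (Suc n A)
  note A = Suc.prems(1) and sym = Suc.prems(2)
  obtain e where "eigenvalue A e" using real_symmetric_eigenvalue_exists[OF A sym] by blast
  then obtain v where v: "v \<in> carrier_vec (Suc n)" "v \<noteq> 0\<^sub>v (Suc n)" "A *\<^sub>v v = e \<cdot>\<^sub>v v"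
    using A unfolding eigenvalue_def eigenvector_def by auto
  obtain W c where W: "W \<in> carrier_mat (Suc n) (Suc n)" "transpose_mat W * W = 1\<^sub>m (Suc n)"
      "col W 0 = c \<cdot>\<^sub>v v"
    using orthogonal_matrix_with_first_column[OF v(1,2)] by blast
  define B where "B = transpose_mat W * A * W"
  have B: "B \<in> carrier_mat (Suc n) (Suc n)" using A W by (simp add: B_def)
  have symB: "transpose_mat B = B"
    unfolding B_def by (rule transpose_congruence[OF A W(1) sym])
  have B0: "B $$ (i, 0) = (if i = 0 then e else 0)" if i: "i < Suc n" for i
  proof -
    have "B $$ (i, 0) = (transpose_mat W * (A * W)) $$ (i, 0)"
      using A W by (simp add: B_def assoc_mult_mat[of _ "Suc n" "Suc n" _ "Suc n" _ "Suc n"])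
    also have "\<dots> = col W i \<bullet> (A *\<^sub>v col W 0)"
      using i A W(1) by (simp add: mult_mat_vec_def)
    also have "A *\<^sub>v col W 0 = e \<cdot>\<^sub>v col W 0"
      using v A W(3) by (simp add: mult_mat_vec[of _ "Suc n" "Suc n"] smult_smult_assoc mult.commute)
    also have "col W i \<bullet> (e \<cdot>\<^sub>v col W 0) = e * (col W i \<bullet> col W 0)"
      using W(1) by simp
    also have "col W i \<bullet> col W 0 = (transpose_mat W * W) $$ (i, 0)" using i W(1) by simp
    finally show ?thesis using i W(2) by simp
  qed
  define M where "M = mat n n (\<lambda>(i, j). B $$ (Suc i, Suc j))"
  have M: "M \<in> carrier_mat n n" by (simp add: M_def)
  have "transpose_mat M = M"
    by (rule eq_matI) (auto simp: M_def symmetric_mat_index[OF B symB])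
  from Suc.IH[OF M this] obtain U D where
    U: "U \<in> carrier_mat n n" "transpose_mat U * U = 1\<^sub>m n" and
    D: "D \<in> carrier_mat n n" "diagonal_mat D" "transpose_mat U * M * U = D" by blast
  let ?e = "mat 1 1 (\<lambda>_. e)" and ?z = "0\<^sub>m 1 n :: real mat" and ?z' = "0\<^sub>m n 1 :: real mat"
  have Bblock: "B = four_block_mat ?e ?z ?z' M"
  proof (rule eq_matI)
    fix i j assume "i < dim_row (four_block_mat ?e ?z ?z' M)" "j < dim_col (four_block_mat ?e ?z ?z' M)"
    hence ij: "i < Suc n" "j < Suc n" using M by auto
    show "B $$ (i, j) = four_block_mat ?e ?z ?z' M $$ (i, j)"
      using ij B0[OF ij(1)] B0[OF ij(2)] symmetric_mat_index[OF B symB ij] M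
      by (cases i; cases j) (auto simp: M_def)
  qed (use B M in auto)
  define V where "V = four_block_mat (1\<^sub>m 1) ?z ?z' U"
  have V: "V \<in> carrier_mat (Suc n) (Suc n)"
    using four_block_carrier_mat[of "1\<^sub>m 1" 1 1 U n n] U by (simp add: V_def)
  have VT: "transpose_mat V = four_block_mat (1\<^sub>m 1) ?z ?z' (transpose_mat U)"
    unfolding V_def using U by (subst transpose_four_block_mat[of _ 1 1 _ n _ n]) auto
  have "transpose_mat V * V = four_block_mat (1\<^sub>m 1) ?z ?z' (1\<^sub>m n)"
    unfolding VT unfolding V_def using U
    by (subst mult_four_block_mat[of _ 1 1 _ n _ n _ _ 1 _ n]) auto
  also have "\<dots> = 1\<^sub>m (1 + n)" by (rule four_block_one_mat)
  finally have V1: "transpose_mat V * V = 1\<^sub>m (Suc n)" by simp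
  have "transpose_mat V * B * V = four_block_mat ?e ?z ?z' D"
    unfolding VT Bblock unfolding V_def using U M D
    by (simp add: mult_four_block_mat[of _ 1 1 _ n _ n _ _ 1 _ n])
  moreover have "diagonal_mat (four_block_mat ?e ?z ?z' D)"
    using D(1,2) by (auto simp: diagonal_mat_def)
  moreover have "four_block_mat ?e ?z ?z' D \<in> carrier_mat (Suc n) (Suc n)"
    using four_block_carrier_mat[of ?e 1 1 D n n] D by simp
  moreover have "transpose_mat (W * V) * (W * V) = transpose_mat V * (transpose_mat W * W) * V"
    using W(1) V by (simp add: transpose_mult[of _ "Suc n" "Suc n" _ "Suc n"]
        assoc_mult_mat[of _ "Suc n" "Suc n" _ "Suc n" _ "Suc n"])
  hence "transpose_mat (W * V) * (W * V) = 1\<^sub>m (Suc n)" using W(2) V V1 by simp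
  moreover have "transpose_mat (W * V) * A * (W * V) = transpose_mat V * B * V"
    using W(1) V A by (simp add: B_def transpose_mult[of _ "Suc n" "Suc n" _ "Suc n"]
        assoc_mult_mat[of _ "Suc n" "Suc n" _ "Suc n" _ "Suc n"])
  ultimately show ?case using W(1) V
    by (intro exI[of _ "W * V"] exI[of _ "four_block_mat ?e ?z ?z' D"] conjI) simp_all
qed

text \<open>
  The vectors \<open>u 0, \<dots>, u (n - 1)\<close> are orthonormal eigenvectors of \<open>a\<close> for the eigenvalues
  \<open>e k\<close>.  The two orthogonality relations say that the matrix of the \<open>u k\<close> has its transpose as a
  left and as a right inverse.  Indexed functions replace matrices here because the forms
  studied below live on arbitrary vertex sets.
\<close>

definition eigenbasis ::
    "nat \<Rightarrow> (nat \<Rightarrow> nat \<Rightarrow> real) \<Rightarrow> (nat \<Rightarrow> real) \<Rightarrow> (nat \<Rightarrow> nat \<Rightarrow> real) \<Rightarrow> bool" where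
  "eigenbasis n a e u \<longleftrightarrow>
     (\<forall>i<n. \<forall>j<n. a i j = (\<Sum>k<n. e k * u k i * u k j)) \<and>
     (\<forall>k<n. \<forall>l<n. (\<Sum>i<n. u k i * u l i) = (if k = l then 1 else 0)) \<and>
     (\<forall>i<n. \<forall>j<n. (\<Sum>k<n. u k i * u k j) = (if i = j then 1 else 0))"

lemma eigenbasisD:
  assumes "eigenbasis n a e u"
  shows "i < n \<Longrightarrow> j < n \<Longrightarrow> a i j = (\<Sum>k<n. e k * u k i * u k j)"
    and "i < n \<Longrightarrow> j < n \<Longrightarrow> (\<Sum>k<n. u i k * u j k) = (if i = j then 1 else 0)"
    and "i < n \<Longrightarrow> j < n \<Longrightarrow> (\<Sum>k<n. u k i * u k j) = (if i = j then 1 else 0)"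
  using assms unfolding eigenbasis_def by simp_all

lemma real_symmetric_spectral_decomposition:
  fixes A :: "real mat"
  assumes A: "A \<in> carrier_mat n n" and sym: "transpose_mat A = A"
  obtains e u where "eigenbasis n (\<lambda>i j. A $$ (i, j)) e u" "char_poly A = (\<Prod>k<n. [:- e k, 1:])"
proof -
  obtain U D where U: "U \<in> carrier_mat n n" "transpose_mat U * U = 1\<^sub>m n"
    and D: "D \<in> carrier_mat n n" "diagonal_mat D" "transpose_mat U * A * U = D"
    using real_symmetric_diagonalization[OF A sym] by blast
  have UT: "transpose_mat U \<in> carrier_mat n n" using U by simp
  have UU: "U * transpose_mat U = 1\<^sub>m n" by (rule mat_mult_left_right_inverse[OF UT U(1,2)])
  have "U * D * transpose_mat U = (U * transpose_mat U) * A * (U * transpose_mat U)"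
    using U(1) A UT by (simp flip: D(3) add: assoc_mult_mat[of _ n n _ n _ n])
  hence AD: "A = U * D * transpose_mat U" using UU A by simp
  have "similar_mat A D"
    by (rule similar_matI[OF _ UU U(2) AD]) (use A D U in auto)
  hence "char_poly A = char_poly D" by (rule char_poly_similar)
  also have "\<dots> = (\<Prod>a\<leftarrow>diag_mat D. [:- a, 1:])"
    by (rule char_poly_upper_triangular[OF D(1)])
       (use D(1,2) in \<open>auto simp: diagonal_mat_def upper_triangular_def\<close>)
  also have "\<dots> = (\<Prod>k<n. [:- (D $$ (k, k)), 1:])"
    using D(1) by (simp add: diag_mat_def o_def atLeast0LessThan flip: prod.distinct_set_conv_list)
  finally have cp: "char_poly A = (\<Prod>k<n. [:- (D $$ (k, k)), 1:])" .
  have UD: "(U * D) $$ (i, k) = D $$ (k, k) * U $$ (i, k)" if "i < n" "k < n" for i k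
  proof -
    have "(U * D) $$ (i, k) = (\<Sum>l<n. U $$ (i, l) * D $$ (l, k))"
      using that U(1) D(1) by (simp add: scalar_prod_def atLeast0LessThan)
    also have "\<dots> = (\<Sum>l<n. if l = k then D $$ (k, k) * U $$ (i, k) else 0)"
      using D(1,2) that by (intro sum.cong refl) (auto simp: diagonal_mat_def)
    finally show ?thesis using that by simp
  qed
  have dec: "A $$ (i, j) = (\<Sum>k<n. D $$ (k, k) * U $$ (i, k) * U $$ (j, k))"
    if "i < n" "j < n" for i j
  proof -
    have "A $$ (i, j) = row (U * D) i \<bullet> col (transpose_mat U) j"
      using that U(1) D(1) by (subst AD, subst index_mult_mat(1)) auto
    also have "\<dots> = (\<Sum>k<n. row (U * D) i $ k * U $$ (j, k))"
      using that U(1) by (simp add: scalar_prod_def atLeast0LessThan)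
    also have "\<dots> = (\<Sum>k<n. (U * D) $$ (i, k) * U $$ (j, k))"
      by (intro sum.cong refl arg_cong2[where f = "(*)"] index_row(1)) (use that U(1) D(1) in auto)
    finally show ?thesis using UD that by simp
  qed
  have o1: "(\<Sum>i<n. U $$ (i, k) * U $$ (i, l)) = (if k = l then 1 else 0)"
    if "k < n" "l < n" for k l
  proof -
    have "(transpose_mat U * U) $$ (k, l) = (\<Sum>i<n. U $$ (i, k) * U $$ (i, l))"
      using that U(1) by (simp add: scalar_prod_def atLeast0LessThan)
    thus ?thesis using that U(2) by simp
  qed
  have o2: "(\<Sum>k<n. U $$ (i, k) * U $$ (j, k)) = (if i = j then 1 else 0)"
    if "i < n" "j < n" for i j
  proof -
    have "(U * transpose_mat U) $$ (i, j) = (\<Sum>k<n. U $$ (i, k) * U $$ (j, k))"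
      using that U(1) by (simp add: scalar_prod_def atLeast0LessThan)
    thus ?thesis using that UU by simp
  qed
  have "eigenbasis n (\<lambda>i j. A $$ (i, j)) (\<lambda>k. D $$ (k, k)) (\<lambda>k i. U $$ (i, k))"
    using dec o1 o2 unfolding eigenbasis_def by simp
  thus ?thesis using cp by (rule that)
qed

lemma order_prod_linear_factors:
  fixes e :: "'b \<Rightarrow> 'a :: idom"
  assumes "finite I"
  shows "Polynomial.order x (\<Prod>k\<in>I. [:- e k, 1:]) = card {k \<in> I. e k = x}"
  using assms
proof (induction I rule: finite_induct)
  case (insert i I)
  have nz: "(\<Prod>k\<in>I. [:- e k, 1:]) \<noteq> 0" using insert(1) by simp
  have ne: "[:- e i, 1:] * (\<Prod>k\<in>I. [:- e k, 1:]) \<noteq> 0" using nz by (metis mult_eq_0_iff one_neq_zero pCons_eq_0_iff)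
  have "{k \<in> insert i I. e k = x} = (if e i = x then insert i {k \<in> I. e k = x} else {k \<in> I. e k = x})"
    by auto
  thus ?case using insert ne
    by (simp add: order_mult order_linear' del: mult_pCons_left)
qed simp

text \<open>
  Connects the eigenvalue counts of partial inertia, which sum root orders over distinct
  eigenvalues, with a count of indices in a list of eigenvalues with repetitions.
\<close>

lemma sum_order_char_poly:
  fixes A :: "'a :: field mat"
  assumes A: "A \<in> carrier_mat n n" and cp: "char_poly A = (\<Prod>k<n. [:- e k, 1:])"
  shows "(\<Sum>x | eigenvalue A x \<and> P x. Polynomial.order x (char_poly A)) = card {k. k < n \<and> P (e k)}"
proof -
  have ev: "eigenvalue A x \<longleftrightarrow> x \<in> e ` {..<n}" for x
    unfolding eigenvalue_root_char_poly[OF A] cp by (auto simp: poly_prod)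
  have "(\<Sum>x | eigenvalue A x \<and> P x. Polynomial.order x (char_poly A)) =
      (\<Sum>x\<in>{x \<in> e ` {..<n}. P x}. card {k \<in> {..<n}. e k = x})"
    by (simp add: ev cp order_prod_linear_factors)
  also have "\<dots> = (\<Sum>x\<in>{x \<in> e ` {..<n}. P x}. card {k \<in> {k. k < n \<and> P (e k)}. e k = x})"
    by (intro sum.cong refl arg_cong[where f = card]) auto
  also have "\<dots> = card {k. k < n \<and> P (e k)}"
    using sum.group[of "{k. k < n \<and> P (e k)}" "{x \<in> e ` {..<n}. P x}" e "\<lambda>_. 1::nat"] by force
  finally show ?thesis .
qed

section \<open>Inertia from vectors\<close>

text \<open>
  Gaussian elimination: an equation with a nonzero coefficient at \<open>p\<close> is solved for the unknown
  \<open>p\<close> and removed together with it.  All dimension comparisons below rest on this fact.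
\<close>

lemma homogeneous_system_nontrivial_solution:
  fixes f :: "'j \<Rightarrow> 'i \<Rightarrow> 'a :: field"
  assumes "finite J" "finite I" "card J < card I"
  shows "\<exists>c. (\<exists>i\<in>I. c i \<noteq> 0) \<and> (\<forall>j\<in>J. (\<Sum>i\<in>I. c i * f j i) = 0)"
  using assms
proof (induction J arbitrary: I f rule: finite_induct)
  case empty
  then obtain i where "i \<in> I" by (metis all_not_in_conv card.empty less_irrefl)
  thus ?case by (intro exI[of _ "\<lambda>_. 1"]) auto
next
  case (insert j J I f)
  show ?case
  proof (cases "\<exists>p\<in>I. f j p \<noteq> 0")
    case False
    thus ?thesis using insert.IH[of I f] insert.prems insert.hyps by auto
  next
    case True
    then obtain p where p: "p \<in> I" "f j p \<noteq> 0" by blast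
    define g where "g k i = f k i - f k p * f j i / f j p" for k i
    have "card J < card (I - {p})" using insert p by simp
    then obtain c where c: "\<exists>i\<in>I - {p}. c i \<noteq> 0"
        "\<forall>k\<in>J. (\<Sum>i\<in>I - {p}. c i * g k i) = 0"
      using insert.IH[of "I - {p}" g] insert.prems by auto
    \<comment> \<open>The value at \<open>p\<close> is the one that equation \<open>j\<close> prescribes.\<close>
    define d where "d = c(p := - (\<Sum>i\<in>I - {p}. c i * f j i) / f j p)"
    have split: "(\<Sum>i\<in>I. d i * f k i) = (\<Sum>i\<in>I - {p}. c i * g k i)" for k
    proof -
      have "(\<Sum>i\<in>I. d i * f k i) = d p * f k p + (\<Sum>i\<in>I - {p}. c i * f k i)"
        using p insert.prems(1) by (simp add: sum.remove[of I p] d_def)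
      also have "d p * f k p = (\<Sum>i\<in>I - {p}. - c i * (f k p * f j i / f j p))"
        by (simp add: d_def sum_divide_distrib sum_distrib_left sum_distrib_right sum_negf mult_ac)
      finally show ?thesis by (simp add: g_def algebra_simps flip: sum.distrib)
    qed
    have "g j i = 0" for i using p by (simp add: g_def)
    hence "\<forall>k\<in>insert j J. (\<Sum>i\<in>I. d i * f k i) = 0" using c(2) by (simp add: split)
    moreover have "\<exists>i\<in>I. d i \<noteq> 0" using c(1) by (auto simp: d_def)
    ultimately show ?thesis by blast
  qed
qed

text \<open>
  The bilinear form of \<open>a\<close> restricted to vectors supported in \<open>V\<close>; deleting vertices of a graph
  becomes shrinking \<open>V\<close>, with no change of indices.
\<close>

definition bform :: "'a set \<Rightarrow> ('a \<Rightarrow> 'a \<Rightarrow> real) \<Rightarrow> ('a \<Rightarrow> real) \<Rightarrow> ('a \<Rightarrow> real) \<Rightarrow> real" where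
  "bform V a x y = (\<Sum>i\<in>V. \<Sum>j\<in>V. a i j * x i * y j)"

text \<open>
  Vectors that are pairwise orthogonal for the form and on which it is positive span a positive
  definite subspace, so this says that \<open>V\<close> carries such a subspace of dimension \<open>r\<close>.  The
  negative analogue is obtained from \<open>- a\<close>.
\<close>

definition has_positive_family :: "'a set \<Rightarrow> ('a \<Rightarrow> 'a \<Rightarrow> real) \<Rightarrow> nat \<Rightarrow> bool" where
  "has_positive_family V a r \<longleftrightarrow> (\<exists>f :: nat \<Rightarrow> 'a \<Rightarrow> real.
     (\<forall>i<r. 0 < bform V a (f i) (f i)) \<and>
     (\<forall>i<r. \<forall>j<r. i \<noteq> j \<longrightarrow> bform V a (f i) (f j) = 0))"

lemma bform_cong:
  assumes "\<And>i j. i \<in> V \<Longrightarrow> j \<in> V \<Longrightarrow> a i j = a' i j"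
    "\<And>i. i \<in> V \<Longrightarrow> x i = x' i" "\<And>i. i \<in> V \<Longrightarrow> y i = y' i"
  shows "bform V a x y = bform V a' x' y'"
  unfolding bform_def by (intro sum.cong refl) (simp add: assms)

lemma bform_sum:
  "bform V a (\<lambda>v. \<Sum>i\<in>I. c i * F i v) (\<lambda>v. \<Sum>j\<in>J. d j * G j v) =
    (\<Sum>i\<in>I. \<Sum>j\<in>J. c i * d j * bform V a (F i) (G j))"
proof -
  have "bform V a (\<lambda>v. \<Sum>i\<in>I. c i * F i v) (\<lambda>v. \<Sum>j\<in>J. d j * G j v) =
      (\<Sum>v\<in>V. \<Sum>w\<in>V. \<Sum>i\<in>I. \<Sum>j\<in>J. c i * d j * (a v w * F i v * G j w))"
    unfolding bform_def
    by (intro sum.cong refl, simp only: mult.assoc sum_product)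
       (simp add: sum_distrib_left mult_ac)
  also have "\<dots> = (\<Sum>v\<in>V. \<Sum>i\<in>I. \<Sum>j\<in>J. \<Sum>w\<in>V. c i * d j * (a v w * F i v * G j w))"
    by (subst (2) sum.swap, subst (3) sum.swap) simp
  also have "\<dots> = (\<Sum>i\<in>I. \<Sum>j\<in>J. \<Sum>v\<in>V. \<Sum>w\<in>V. c i * d j * (a v w * F i v * G j w))"
    by (subst sum.swap, subst (2) sum.swap) simp
  finally show ?thesis by (simp add: bform_def sum_distrib_left)
qed

lemma bform_spectral:
  fixes n :: nat
  assumes a: "\<And>i j. i < n \<Longrightarrow> j < n \<Longrightarrow> a i j = (\<Sum>k<n. e k * u k i * u k j)"
  shows "bform {..<n} a x y = (\<Sum>k<n. e k * (\<Sum>i<n. x i * u k i) * (\<Sum>j<n. y j * u k j))"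
proof -
  have "bform {..<n} a x y = (\<Sum>i<n. \<Sum>j<n. \<Sum>k<n. e k * (x i * u k i) * (y j * u k j))"
    unfolding bform_def
    by (intro sum.cong refl) (simp add: a sum_distrib_left sum_distrib_right mult_ac)
  also have "\<dots> = (\<Sum>i<n. \<Sum>k<n. \<Sum>j<n. e k * (x i * u k i) * (y j * u k j))"
    by (subst (2) sum.swap) simp
  also have "\<dots> = (\<Sum>k<n. \<Sum>i<n. \<Sum>j<n. e k * (x i * u k i) * (y j * u k j))"
    by (rule sum.swap)
  also have "\<dots> = (\<Sum>k<n. e k * (\<Sum>i<n. x i * u k i) * (\<Sum>j<n. y j * u k j))"
    by (intro sum.cong refl) (simp add: sum_product sum_distrib_left mult_ac)
  finally show ?thesis .
qed

text \<open>
  One half of Sylvester's law of inertia.  If the family were larger than the number of positive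
  eigenvalues, some nontrivial combination \<open>x\<close> of it would have vanishing coordinates along all
  eigenvectors with positive eigenvalue.  The form is then nonpositive at \<open>x\<close> by the spectral
  expansion, and positive at \<open>x\<close> because the family is orthogonal.
\<close>

lemma positive_family_le_card_positive:
  fixes n :: nat
  assumes a: "\<And>i j. i < n \<Longrightarrow> j < n \<Longrightarrow> a i j = (\<Sum>k<n. e k * u k i * u k j)"
    and fam: "has_positive_family {..<n} a r"
  shows "r \<le> card {k. k < n \<and> 0 < e k}"
proof (rule ccontr)
  assume "\<not> ?thesis"
  hence less: "card {k. k < n \<and> 0 < e k} < card {..<r}" by simp
  obtain F where F: "\<And>i. i < r \<Longrightarrow> 0 < bform {..<n} a (F i) (F i)"
      "\<And>i j. i < r \<Longrightarrow> j < r \<Longrightarrow> i \<noteq> j \<Longrightarrow> bform {..<n} a (F i) (F j) = 0"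
    using fam unfolding has_positive_family_def by blast
  obtain c where c: "\<exists>i<r. c i \<noteq> 0"
      "\<And>k. k < n \<Longrightarrow> 0 < e k \<Longrightarrow> (\<Sum>i<r. c i * (\<Sum>j<n. F i j * u k j)) = 0"
    using homogeneous_system_nontrivial_solution[OF _ _ less, of "\<lambda>k i. \<Sum>j<n. F i j * u k j"]
    by auto
  define x where "x = (\<lambda>j. \<Sum>i<r. c i * F i j)"
  have lin: "(\<Sum>j<n. x j * u k j) = (\<Sum>i<r. c i * (\<Sum>j<n. F i j * u k j))" for k
    unfolding x_def by (simp add: sum_distrib_right sum_distrib_left mult_ac) (rule sum.swap)
  have "bform {..<n} a x x = (\<Sum>k<n. e k * (\<Sum>j<n. x j * u k j)\<^sup>2)"
    by (simp add: bform_spectral[where e = e and u = u, OF a] power2_eq_square mult.assoc)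
  also have "\<dots> \<le> 0"
  proof (intro sum_nonpos)
    fix k assume "k \<in> {..<n}"
    thus "e k * (\<Sum>j<n. x j * u k j)\<^sup>2 \<le> 0"
      using c(2)[of k] by (cases "0 < e k") (auto simp: lin intro: mult_nonpos_nonneg)
  qed
  finally have le: "bform {..<n} a x x \<le> 0" .
  have "bform {..<n} a x x = (\<Sum>i<r. \<Sum>j<r. c i * c j * bform {..<n} a (F i) (F j))"
    unfolding x_def by (rule bform_sum)
  also have "\<dots> = (\<Sum>i<r. \<Sum>j<r. if j = i then (c i)\<^sup>2 * bform {..<n} a (F i) (F i) else 0)"
    by (intro sum.cong refl) (auto simp: F(2) power2_eq_square)
  also have "\<dots> = (\<Sum>i<r. (c i)\<^sup>2 * bform {..<n} a (F i) (F i))"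
    by simp
  also obtain i where "i < r" "c i \<noteq> 0" using c(1) by blast
  hence "(\<Sum>i<r. (c i)\<^sup>2 * bform {..<n} a (F i) (F i)) > 0"
    using F(1) by (intro sum_pos2[of _ i]) (auto intro!: mult_nonneg_nonneg simp: less_imp_le)
  finally show False using le by simp
qed

text \<open>
  A kernel vector is orthogonal to every eigenvector with nonzero eigenvalue.  With more kernel
  vectors than zero eigenvalues, a nontrivial combination is also orthogonal to the remaining
  eigenvectors, hence vanishes.
\<close>

lemma kernel_family_le_card_zero:
  fixes n :: nat and F :: "'w \<Rightarrow> nat \<Rightarrow> real"
  assumes eu: "eigenbasis n a e u"
    and fin: "finite I"
    and ker: "\<And>w i. w \<in> I \<Longrightarrow> i < n \<Longrightarrow> (\<Sum>j<n. a i j * F w j) = 0"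
    and indep: "\<And>c. (\<And>j. j < n \<Longrightarrow> (\<Sum>w\<in>I. c w * F w j) = 0) \<Longrightarrow> \<forall>w\<in>I. c w = 0"
  shows "card I \<le> card {k. k < n \<and> e k = 0}"
proof (rule ccontr)
  assume "\<not> ?thesis"
  hence less: "card {k. k < n \<and> e k = 0} < card I" by simp
  obtain c where c: "\<exists>w\<in>I. c w \<noteq> 0"
      "\<And>k. k < n \<Longrightarrow> e k = 0 \<Longrightarrow> (\<Sum>w\<in>I. c w * (\<Sum>j<n. F w j * u k j)) = 0"
    using homogeneous_system_nontrivial_solution[OF _ fin less, of "\<lambda>k w. \<Sum>j<n. F w j * u k j"]
    by auto
  have nz: "(\<Sum>j<n. F w j * u k j) = 0" if "k < n" "e k \<noteq> 0" "w \<in> I" for k w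
  proof -
    have "e k * (\<Sum>j<n. F w j * u k j) =
        (\<Sum>l<n. if k = l then e l * (\<Sum>j<n. F w j * u l j) else 0)"
      using that(1) by simp
    also have "\<dots> = (\<Sum>l<n. e l * (\<Sum>i<n. u k i * u l i) * (\<Sum>j<n. F w j * u l j))"
      using that(1) by (intro sum.cong refl) (simp add: eigenbasisD(2)[OF eu])
    also have "\<dots> = bform {..<n} a (u k) (F w)"
      by (rule bform_spectral[where e = e and u = u, OF eigenbasisD(1)[OF eu], symmetric])
    also have "\<dots> = (\<Sum>i<n. u k i * (\<Sum>j<n. a i j * F w j))"
      by (simp add: bform_def sum_distrib_left mult_ac)
    also have "\<dots> = 0" using ker[OF that(3)] by simp
    finally show ?thesis using that(2) by simp
  qed
  define x where "x = (\<lambda>j. \<Sum>w\<in>I. c w * F w j)"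
  have "(\<Sum>j<n. x j * u k j) = (\<Sum>w\<in>I. c w * (\<Sum>j<n. F w j * u k j))" for k
    unfolding x_def by (simp add: sum_distrib_right sum_distrib_left mult_ac) (rule sum.swap)
  hence coord: "(\<Sum>j<n. x j * u k j) = 0" if "k < n" for k
    using c(2)[OF that] nz[OF that] by (cases "e k = 0") auto
  have "x i = 0" if "i < n" for i
  proof -
    have "x i = (\<Sum>j<n. if i = j then x j else 0)"
      using that by simp
    also have "\<dots> = (\<Sum>j<n. x j * (\<Sum>k<n. u k i * u k j))"
      using that by (intro sum.cong refl) (simp add: eigenbasisD(3)[OF eu])
    also have "\<dots> = (\<Sum>k<n. u k i * (\<Sum>j<n. x j * u k j))"
      by (simp add: sum_distrib_left mult_ac) (rule sum.swap)
    also have "\<dots> = 0" using coord by simp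
    finally show ?thesis .
  qed
  with indep[of c] c(1) show False unfolding x_def by blast
qed

lemma inertia_spectral:
  assumes A: "A \<in> carrier_mat n n" and sym: "transpose_mat A = A"
  obtains e u where "eigenbasis n (\<lambda>i j. A $$ (i, j)) e u"
    "num_pos_eigenvalues A = card {k. k < n \<and> 0 < e k}"
    "num_neg_eigenvalues A = card {k. k < n \<and> e k < 0}"
proof -
  obtain e u where *: "eigenbasis n (\<lambda>i j. A $$ (i, j)) e u" "char_poly A = (\<Prod>k<n. [:- e k, 1:])"
    using real_symmetric_spectral_decomposition[OF A sym] by blast
  show ?thesis
    by (rule that[OF *(1)])
       (auto simp: num_pos_eigenvalues_def num_neg_eigenvalues_def sum_order_char_poly[OF A *(2)])
qed

lemma positive_family_le_num_pos_eigenvalues: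
  assumes A: "A \<in> carrier_mat n n" and sym: "transpose_mat A = A"
    and fam: "has_positive_family {..<n} (\<lambda>i j. A $$ (i, j)) r"
  shows "r \<le> num_pos_eigenvalues A"
proof -
  obtain e u where eb: "eigenbasis n (\<lambda>i j. A $$ (i, j)) e u"
      and "num_pos_eigenvalues A = card {k. k < n \<and> 0 < e k}"
    using inertia_spectral[OF A sym] by blast
  thus ?thesis
    using positive_family_le_card_positive[OF eigenbasisD(1)[OF eb] fam] by simp
qed

lemma negative_family_le_num_neg_eigenvalues:
  assumes A: "A \<in> carrier_mat n n" and sym: "transpose_mat A = A"
    and fam: "has_positive_family {..<n} (\<lambda>i j. - A $$ (i, j)) s"
  shows "s \<le> num_neg_eigenvalues A"
proof -
  obtain e u where eb: "eigenbasis n (\<lambda>i j. A $$ (i, j)) e u"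
      and "num_neg_eigenvalues A = card {k. k < n \<and> e k < 0}"
    using inertia_spectral[OF A sym] by blast
  moreover have "- A $$ (i, j) = (\<Sum>k<n. - e k * u k i * u k j)" if "i < n" "j < n" for i j
    using eigenbasisD(1)[OF eb that] by (simp add: sum_negf)
  ultimately show ?thesis
    using positive_family_le_card_positive[where e = "\<lambda>k. - e k" and u = u, OF _ fam] by simp
qed

lemma num_pos_plus_num_neg_le:
  assumes A: "A \<in> carrier_mat n n" and sym: "transpose_mat A = A"
  shows "num_pos_eigenvalues A + num_neg_eigenvalues A \<le> n"
proof -
  obtain e where eu: "num_pos_eigenvalues A = card {k. k < n \<and> 0 < e k}"
      "num_neg_eigenvalues A = card {k. k < n \<and> e k < (0::real)}"
    using inertia_spectral[OF A sym] by blast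
  have "card {k. k < n \<and> 0 < e k} + card {k. k < n \<and> e k < 0} =
      card ({k. k < n \<and> 0 < e k} \<union> {k. k < n \<and> e k < 0})"
    by (intro card_Un_disjoint[symmetric]) auto
  also have "\<dots> \<le> card {..<n}" by (intro card_mono) auto
  finally show ?thesis using eu by simp
qed

lemma positive_semidefinite_inertia:
  fixes F :: "'w \<Rightarrow> nat \<Rightarrow> real"
  assumes A: "A \<in> carrier_mat n n" and sym: "transpose_mat A = A"
    and psd: "\<And>x. 0 \<le> bform {..<n} (\<lambda>i j. A $$ (i, j)) x x"
    and fin: "finite I"
    and ker: "\<And>w i. w \<in> I \<Longrightarrow> i < n \<Longrightarrow> (\<Sum>j<n. A $$ (i, j) * F w j) = 0"
    and indep: "\<And>c. (\<And>j. j < n \<Longrightarrow> (\<Sum>w\<in>I. c w * F w j) = 0) \<Longrightarrow> \<forall>w\<in>I. c w = 0"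
  shows "num_neg_eigenvalues A = 0" "num_pos_eigenvalues A + card I \<le> n"
proof -
  obtain e u where eb: "eigenbasis n (\<lambda>i j. A $$ (i, j)) e u"
    and pos: "num_pos_eigenvalues A = card {k. k < n \<and> 0 < e k}"
    and neg: "num_neg_eigenvalues A = card {k. k < n \<and> e k < 0}"
    using inertia_spectral[OF A sym] by blast
  have "0 \<le> e k" if "k < n" for k
  proof -
    have "bform {..<n} (\<lambda>i j. A $$ (i, j)) (u k) (u k) =
        (\<Sum>l<n. e l * (\<Sum>i<n. u k i * u l i) * (\<Sum>j<n. u k j * u l j))"
      by (rule bform_spectral[where e = e and u = u, OF eigenbasisD(1)[OF eb]])
    also have "\<dots> = (\<Sum>l<n. if k = l then e l else 0)"
      using that by (intro sum.cong refl) (simp add: eigenbasisD(2)[OF eb])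
    finally show ?thesis using psd[of "u k"] that by simp
  qed
  hence "{k. k < n \<and> e k < 0} = {}" by force
  thus "num_neg_eigenvalues A = 0" using neg by simp
  have "card I \<le> card {k. k < n \<and> e k = 0}"
    using eb fin ker indep by (rule kernel_family_le_card_zero)
  moreover have "card {k. k < n \<and> 0 < e k} + card {k. k < n \<and> e k = 0} =
      card ({k. k < n \<and> 0 < e k} \<union> {k. k < n \<and> e k = 0})"
    by (intro card_Un_disjoint[symmetric]) auto
  moreover have "\<dots> \<le> card {..<n}" by (intro card_mono) auto
  ultimately show "num_pos_eigenvalues A + card I \<le> n" using pos by simp
qed

text \<open>
  The range of a symmetric matrix is the orthogonal complement of its kernel.  The solution
  divides the coordinates of \<open>b\<close> in the eigenbasis by the eigenvalues; for a zero eigenvalue the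
  coordinate is zero, and so is the quotient by the convention for division by zero.
\<close>

lemma symmetric_system_solvable:
  fixes a :: "nat \<Rightarrow> nat \<Rightarrow> real"
  assumes sym: "\<And>i j. i < n \<Longrightarrow> j < n \<Longrightarrow> a i j = a j i"
    and b: "\<And>x. (\<And>i. i < n \<Longrightarrow> (\<Sum>j<n. a i j * x j) = 0) \<Longrightarrow> (\<Sum>j<n. b j * x j) = 0"
  obtains y where "\<And>i. i < n \<Longrightarrow> (\<Sum>j<n. a i j * y j) = b i"
proof -
  define A where "A = mat n n (\<lambda>(i, j). a i j)"
  have A: "A \<in> carrier_mat n n" by (simp add: A_def)
  have "transpose_mat A = A" by (rule eq_matI) (auto simp: A_def sym)
  from inertia_spectral[OF A this] obtain e u where
    eb: "eigenbasis n (\<lambda>i j. A $$ (i, j)) e u" by blast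
  have a: "a i j = (\<Sum>k<n. e k * u k i * u k j)" if "i < n" "j < n" for i j
    using eigenbasisD(1)[OF eb that] that by (simp add: A_def)
  have act: "(\<Sum>j<n. a i j * x j) = (\<Sum>k<n. e k * u k i * (\<Sum>j<n. u k j * x j))" if "i < n" for i x
  proof -
    have "(\<Sum>j<n. a i j * x j) = (\<Sum>j<n. \<Sum>k<n. e k * u k i * u k j * x j)"
      using that by (intro sum.cong refl) (simp add: a sum_distrib_right)
    also have "\<dots> = (\<Sum>k<n. \<Sum>j<n. e k * u k i * u k j * x j)" by (rule sum.swap)
    finally show ?thesis by (simp add: sum_distrib_left mult.assoc)
  qed
  define g where "g k = (\<Sum>j<n. b j * u k j)" for k
  have g0: "g k = 0" if "k < n" "e k = 0" for k
    unfolding g_def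
  proof (rule b)
    fix i assume i: "i < n"
    have "(\<Sum>l<n. e l * u l i * (\<Sum>j<n. u l j * u k j)) = (\<Sum>l<n. if l = k then e l * u l i else 0)"
      using that by (intro sum.cong refl) (simp add: eigenbasisD(2)[OF eb])
    thus "(\<Sum>j<n. a i j * u k j) = 0" using act[OF i] that by simp
  qed
  define y where "y j = (\<Sum>k<n. g k / e k * u k j)" for j
  have uy: "(\<Sum>j<n. u k j * y j) = g k / e k" if "k < n" for k
  proof -
    have "(\<Sum>j<n. u k j * y j) = (\<Sum>l<n. g l / e l * (\<Sum>j<n. u k j * u l j))"
      unfolding y_def by (simp add: sum_distrib_left mult_ac) (rule sum.swap)
    also have "\<dots> = (\<Sum>l<n. if k = l then g l / e l else 0)"
      using that by (intro sum.cong refl) (simp add: eigenbasisD(2)[OF eb])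
    finally show ?thesis using that by simp
  qed
  have "(\<Sum>j<n. a i j * y j) = b i" if i: "i < n" for i
  proof -
    have "(\<Sum>j<n. a i j * y j) = (\<Sum>k<n. u k i * g k)"
      unfolding act[OF i] using g0 by (intro sum.cong refl) (auto simp: uy)
    also have "\<dots> = (\<Sum>j<n. b j * (\<Sum>k<n. u k i * u k j))"
      unfolding g_def by (simp add: sum_distrib_left mult_ac) (rule sum.swap)
    also have "\<dots> = (\<Sum>j<n. if i = j then b j else 0)"
      using i by (intro sum.cong refl) (simp add: eigenbasisD(3)[OF eb])
    finally show ?thesis using i by simp
  qed
  thus ?thesis by (rule that)
qed

section \<open>Removing a leaf from a quadratic form\<close>

lemma positive_family_pullback:
  assumes ext: "\<And>x y. bform V a (ext x) (ext y) = bform W b x y"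
    and fam: "has_positive_family W b r"
  shows "has_positive_family V a r"
proof -
  obtain f where "\<forall>i<r. 0 < bform W b (f i) (f i)"
      "\<forall>i<r. \<forall>j<r. i \<noteq> j \<longrightarrow> bform W b (f i) (f j) = 0"
    using fam unfolding has_positive_family_def by blast
  thus ?thesis unfolding has_positive_family_def
    by (intro exI[of _ "\<lambda>i. ext (f i)"]) (simp add: ext)
qed

text \<open>
  An isometric copy of the form \<open>b\<close> together with a positive vector \<open>z\<close> orthogonal to it.
\<close>

lemma positive_family_pullback_Suc:
  assumes ext: "\<And>x y. bform V a (ext x) (ext y) = bform W b x y"
    and z: "0 < bform V a z z" "\<And>x. bform V a z (ext x) = 0" "\<And>x. bform V a (ext x) z = 0"
    and fam: "has_positive_family W b r"
  shows "has_positive_family V a (Suc r)"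
proof -
  obtain f where f: "\<forall>i<r. 0 < bform W b (f i) (f i)"
      "\<forall>i<r. \<forall>j<r. i \<noteq> j \<longrightarrow> bform W b (f i) (f j) = 0"
    using fam unfolding has_positive_family_def by blast
  define g where "g i = (if i = r then z else ext (f i))" for i
  have "0 < bform V a (g i) (g i)" if "i < Suc r" for i
    using that f(1) z by (auto simp: g_def ext less_Suc_eq)
  moreover have "bform V a (g i) (g j) = 0" if "i < Suc r" "j < Suc r" "i \<noteq> j" for i j
    using that f(2) z by (auto simp: g_def ext less_Suc_eq)
  ultimately show ?thesis unfolding has_positive_family_def by blast
qed

lemma bform_insert:
  assumes "finite W" "v \<notin> W"
  shows "bform (insert v W) a x y =
    a v v * x v * y v + x v * (\<Sum>j\<in>W. a v j * y j) + y v * (\<Sum>i\<in>W. a i v * x i) + bform W a x y"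
  using assms by (simp add: bform_def sum.distrib sum_distrib_left mult_ac)

lemma bform_leaf:
  assumes W: "finite W" "v \<notin> W" "u \<in> W"
    and leaf: "\<And>j. j \<in> W \<Longrightarrow> j \<noteq> u \<Longrightarrow> a v j = 0 \<and> a j v = 0"
  shows "bform (insert v W) a x y =
    a v v * x v * y v + a v u * x v * y u + a u v * x u * y v + bform W a x y"
proof -
  have "(\<Sum>j\<in>W. a v j * y j) = a v u * y u"
    using W leaf by (simp add: sum.remove[of W u])
  moreover have "(\<Sum>i\<in>W. a i v * x i) = a u v * x u"
    using W leaf by (simp add: sum.remove[of W u])
  ultimately show ?thesis using bform_insert[OF W(1,2)] by (simp add: mult_ac)
qed

lemma bform_update_diagonal:
  assumes "finite W" "u \<in> W"
  shows "bform W (\<lambda>i j. if i = u \<and> j = u then c else a i j) x y =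
    bform W a x y + (c - a u u) * x u * y u"
proof -
  have "bform W (\<lambda>i j. if i = u \<and> j = u then c else a i j) x y =
      (\<Sum>i\<in>W. \<Sum>j\<in>W. a i j * x i * y j + (if j = u then (if i = u then (c - a u u) * x u * y u else 0) else 0))"
    unfolding bform_def by (intro sum.cong refl) (auto simp: algebra_simps)
  also have "\<dots> = bform W a x y + (c - a u u) * x u * y u"
    using assms by (simp add: bform_def sum.distrib)
  finally show ?thesis .
qed

lemma positive_family_insert:
  assumes W: "finite W" "v \<notin> W" and fam: "has_positive_family W a r"
  shows "has_positive_family (insert v W) a r"
proof (rule positive_family_pullback[OF _ fam])
  fix x y
  have "bform (insert v W) a (x(v := 0)) (y(v := 0)) = bform W a (x(v := 0)) (y(v := 0))"
    using bform_insert[OF W, of a "x(v := 0)" "y(v := 0)"] by simp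
  also have "\<dots> = bform W a x y" using W by (intro bform_cong) auto
  finally show "bform (insert v W) a (x(v := 0)) (y(v := 0)) = bform W a x y" .
qed

text \<open>
  Pivoting on the nonzero diagonal entry at the leaf \<open>v\<close>.  The Schur complement changes only the
  diagonal entry at the neighbour \<open>u\<close>, so the matrix of the remaining graph keeps its pattern.
  A vector on \<open>W\<close> is extended to \<open>v\<close> so as to be orthogonal to the unit vector at \<open>v\<close>; that
  unit vector is a further positive vector if the pivot is positive.
\<close>

lemma positive_family_leaf_schur:
  assumes W: "finite W" "v \<notin> W" "u \<in> W"
    and leaf: "\<And>j. j \<in> W \<Longrightarrow> j \<noteq> u \<Longrightarrow> a v j = 0 \<and> a j v = 0"
    and sym: "a u v = a v u" and nz: "a v v \<noteq> 0"
    and fam: "has_positive_family W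
      (\<lambda>i j. if i = u \<and> j = u then a u u - (a v u)\<^sup>2 / a v v else a i j) r"
  shows "has_positive_family (insert v W) a (if 0 < a v v then Suc r else r)"
proof -
  define ext where "ext x = x(v := - a v u * x u / a v v)" for x
  have uv: "u \<noteq> v" using W by blast
  have bl: "bform (insert v W) a x y =
      a v v * x v * y v + a v u * x v * y u + a u v * x u * y v + bform W a x y" for x y
    by (rule bform_leaf[OF W]) (use leaf in auto)
  have ext: "bform (insert v W) a (ext x) (ext y) =
      bform W (\<lambda>i j. if i = u \<and> j = u then a u u - (a v u)\<^sup>2 / a v v else a i j) x y" for x y
  proof -
    have "bform W a (ext x) (ext y) = bform W a x y"
      using W by (intro bform_cong) (auto simp: ext_def)
    thus ?thesis
      using uv nz
      by (simp add: bl bform_update_diagonal[OF W(1,3)] sym)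
         (simp add: ext_def field_simps power2_eq_square)
  qed
  show ?thesis
  proof (cases "0 < a v v")
    case True
    define z where "z = (\<lambda>_. 0)(v := 1 :: real)"
    have z0: "bform W a z y = 0" "bform W a y z = 0" for y
    proof -
      have "bform W a z y = bform W a (\<lambda>_. 0) y" "bform W a y z = bform W a y (\<lambda>_. 0)"
        using W by (auto intro!: bform_cong simp: z_def)
      thus "bform W a z y = 0" "bform W a y z = 0" by (simp_all add: bform_def)
    qed
    have "has_positive_family (insert v W) a (Suc r)"
      by (rule positive_family_pullback_Suc[OF ext _ _ _ fam, of z])
         (use True uv in \<open>simp_all add: bl z0 sym, simp_all add: z_def ext_def\<close>)
    thus ?thesis using True by simp
  next
    case False
    thus ?thesis using positive_family_pullback[OF ext fam] by simp
  qed
qed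

text \<open>
  If the diagonal entry at the leaf \<open>v\<close> is zero, the coordinates \<open>u\<close> and \<open>v\<close> span a hyperbolic
  plane, which contributes one positive and one negative direction whatever the entry at \<open>u\<close> is.
  Its orthogonal complement is isometric to the form on \<open>W\<close>: the coordinate at \<open>v\<close> is free to
  cancel the contribution of row \<open>u\<close>, and the coordinate at \<open>u\<close> is zero.
\<close>

lemma positive_family_leaf_hyperbolic:
  assumes W: "finite W" "v \<notin> W" "u \<notin> W" "u \<noteq> v"
    and leaf: "\<And>j. j \<in> W \<Longrightarrow> a v j = 0 \<and> a j v = 0"
    and sym: "\<And>j. j \<in> insert v W \<Longrightarrow> a u j = a j u" and zero: "a v v = 0" and nz: "a v u \<noteq> 0"
    and fam: "has_positive_family W a r"
  shows "has_positive_family (insert v (insert u W)) a (Suc r)"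
proof -
  let ?U = "insert u W"
  have U: "finite ?U" "v \<notin> ?U" "u \<in> ?U" using W by auto
  have leaf': "a v j = 0 \<and> a j v = 0" if "j \<in> ?U" "j \<noteq> u" for j using leaf that by auto
  have bl: "bform (insert v ?U) a x y =
      a v v * x v * y v + a v u * x v * y u + a u v * x u * y v + bform ?U a x y" for x y
    by (rule bform_leaf[OF U]) (use leaf' in auto)
  have sums: "(\<Sum>j\<in>W. a j u * x j) = (\<Sum>j\<in>W. a u j * x j)" for x
    using sym by (intro sum.cong) auto
  have uv: "a u v = a v u" using sym by auto
  define ext where "ext x = x(u := 0, v := - (\<Sum>j\<in>W. a u j * x j) / a v u)" for x
  have extW: "(\<Sum>j\<in>W. a u j * ext x j) = (\<Sum>j\<in>W. a u j * x j)" for x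
    using W by (intro sum.cong) (auto simp: ext_def)
  have ext0: "ext x u = 0" for x using W by (simp add: ext_def)
  have ext: "bform (insert v ?U) a (ext x) (ext y) = bform W a x y" for x y
  proof -
    have "bform W a (ext x) (ext y) = bform W a x y"
      using W by (intro bform_cong) (auto simp: ext_def)
    thus ?thesis
      unfolding bl bform_insert[OF W(1,3)]
      by (simp add: ext0 zero)
  qed
  \<comment> \<open>The value at \<open>v\<close> is chosen such that the form takes the value 1 at \<open>z\<close>.\<close>
  define z where "z = (\<lambda>_. 0)(u := 1, v := (1 - a u u) / (2 * a v u))"
  have z0: "bform W a z y = 0" "bform W a y z = 0" for y
  proof -
    have "bform W a z y = bform W a (\<lambda>_. 0) y" "bform W a y z = bform W a y (\<lambda>_. 0)"
      using W by (auto intro!: bform_cong simp: z_def)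
    thus "bform W a z y = 0" "bform W a y z = 0" by (simp_all add: bform_def)
  qed
  have zW: "(\<Sum>j\<in>W. a u j * z j) = 0"
    using W by (intro sum.neutral) (auto simp: z_def)
  note expand = bl bform_insert[OF W(1,3)] z0 sums zW extW uv zero
  have zu: "z u = 1" "z v = (1 - a u u) / (2 * a v u)" "ext x u = 0"
    "ext x v = - (\<Sum>j\<in>W. a u j * x j) / a v u" for x
    using W by (auto simp: z_def ext_def)
  show ?thesis
  proof (rule positive_family_pullback_Suc[OF ext _ _ _ fam, of z])
    have "bform (insert v ?U) a z z = 2 * a v u * z v + a u u" by (simp add: expand zu(1))
    also have "\<dots> = 1" using nz by (simp add: zu(2))
    finally have "bform (insert v ?U) a z z = 1" .
    thus "0 < bform (insert v ?U) a z z" by simp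
  qed (use nz in \<open>simp_all add: expand zu\<close>)
qed

section \<open>Forests and inertia certificates\<close>

text \<open>
  Cycles as vertex lists inside a set \<open>V\<close> of vertices: having none is visibly inherited by
  subsets of \<open>V\<close>.
\<close>

definition cycle_list :: "('a \<times> 'a) set \<Rightarrow> 'a set \<Rightarrow> 'a list \<Rightarrow> bool" where
  "cycle_list E V vs \<longleftrightarrow> 3 \<le> length vs \<and> distinct vs \<and> set vs \<subseteq> V \<and>
     successively (\<lambda>x y. (x, y) \<in> E) vs \<and> (last vs, hd vs) \<in> E"

text \<open>
  The first vertex \<open>v\<close> of a longest path has all its neighbours on the path.  A neighbour other
  than the second vertex would close a cycle.
\<close>

lemma acyclic_imp_leaf:
  assumes V: "finite V" "V \<noteq> {}" and E: "sym E" "irrefl E" and acyc: "\<nexists>vs. cycle_list E V vs"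
  shows "\<exists>v\<in>V. \<exists>u. \<forall>j\<in>V. (v, j) \<in> E \<longrightarrow> j = u"
proof (rule ccontr)
  assume neg: "\<not> ?thesis"
  define path where "path vs \<longleftrightarrow> vs \<noteq> [] \<and> distinct vs \<and> set vs \<subseteq> V \<and> successively (\<lambda>x y. (x, y) \<in> E) vs" for vs
  obtain x where "x \<in> V" using V by blast
  hence x: "path [x]" by (simp add: path_def)
  have bound: "\<forall>vs. path vs \<longrightarrow> length vs < Suc (card V)"
  proof (intro allI impI)
    fix vs assume "path vs"
    hence "distinct vs" "set vs \<subseteq> V" by (simp_all add: path_def)
    thus "length vs < Suc (card V)" using card_mono[OF V(1), of "set vs"] by (simp add: distinct_card)
  qed
  obtain vs where vs: "path vs" and max: "\<forall>ws. path ws \<longrightarrow> length ws \<le> length vs"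
    using ex_has_greatest_nat[OF x bound] by (elim exE conjE)
  define v where "v = hd vs"
  have v: "v \<in> V" using vs by (auto simp: v_def path_def)
  with neg obtain j where j: "j \<in> V" "(v, j) \<in> E" "j \<noteq> vs ! 1" by blast
  have jv: "(j, v) \<in> E" using E(1) j(2) by (meson symD)
  have "j \<in> set vs"
  proof (rule ccontr)
    assume "j \<notin> set vs"
    hence "path (j # vs)" using vs j jv by (auto simp: path_def v_def successively_Cons)
    thus False using max by (metis impossible_Cons)
  qed
  then obtain m where m: "m < length vs" "vs ! m = j" by (metis in_set_conv_nth)
  have v0: "vs ! 0 = v" using vs by (simp add: v_def path_def hd_conv_nth)
  have "m \<noteq> 0" using m v0 j E(2) by (metis irrefl_def)
  moreover have "m \<noteq> 1" using m j by auto
  ultimately have m2: "2 \<le> m" by simp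
  have "successively (\<lambda>x y. (x, y) \<in> E) (take (Suc m) vs)"
    using vs successively_append_iff[of _ "take (Suc m) vs" "drop (Suc m) vs"]
    by (simp add: path_def)
  moreover have "last (take (Suc m) vs) = j" using m by (simp add: take_Suc_conv_app_nth)
  moreover have "hd (take (Suc m) vs) = v" by (simp add: v_def)
  moreover have "set (take (Suc m) vs) \<subseteq> V" "distinct (take (Suc m) vs)"
    using vs by (auto simp: path_def dest: in_set_takeD)
  ultimately have "cycle_list E V (take (Suc m) vs)"
    using m m2 jv by (simp add: cycle_list_def)
  thus False using acyc by blast
qed

text \<open>
  The data that witness an elementary inertia.  Removing \<open>S\<close> leaves at least \<open>c\<close> components:
  instead of the components themselves there is a labelling \<open>f\<close> that is constant along edges and
  takes all the values below \<open>c\<close>.  There are at least \<open>r\<close> positive and \<open>s\<close> negative eigenvalues,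
  both numbers are at least \<open>card S\<close>, and the last inequality bounds the nullity by
  \<open>c - card S\<close>.
\<close>

definition inertia_certificate ::
    "('a \<times> 'a) set \<Rightarrow> 'a set \<Rightarrow> ('a \<Rightarrow> 'a \<Rightarrow> real) \<Rightarrow> 'a set \<Rightarrow> nat \<Rightarrow> ('a \<Rightarrow> nat) \<Rightarrow> nat \<Rightarrow> nat \<Rightarrow> bool" where
  "inertia_certificate E V a S c f r s \<longleftrightarrow>
     S \<subseteq> V \<and> (\<forall>i\<in>V - S. \<forall>j\<in>V - S. (i, j) \<in> E \<longrightarrow> f i = f j) \<and> {..<c} \<subseteq> f ` (V - S) \<and>
     has_positive_family V a r \<and> has_positive_family V (\<lambda>i j. - a i j) s \<and>
     card S \<le> r \<and> card S \<le> s \<and> card V + card S \<le> c + r + s"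

text \<open>
  An isolated vertex is a component of its own, which pays for one more dimension.
\<close>

lemma inertia_certificate_isolated:
  assumes W: "finite W" "v \<notin> W" and E: "sym E"
    and iso: "\<And>j. j \<in> insert v W \<Longrightarrow> (v, j) \<notin> E"
    and cert: "inertia_certificate E W a S c f r s"
  shows "inertia_certificate E (insert v W) a S (Suc c) (f(v := c)) r s"
proof -
  have iso': "(j, v) \<notin> E" if "j \<in> insert v W" for j using iso[OF that] E by (meson symD)
  have vS: "v \<notin> S" using cert W by (auto simp: inertia_certificate_def)
  have *: "insert v W - S = insert v (W - S)" using vS by auto
  have "{..<Suc c} \<subseteq> f(v := c) ` (insert v W - S)"
  proof -
    have "f(v := c) ` (W - S) = f ` (W - S)" using W by (intro image_cong) auto
    thus ?thesis using cert unfolding * by (auto simp: inertia_certificate_def lessThan_Suc)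
  qed
  moreover have "\<forall>i\<in>insert v W - S. \<forall>j\<in>insert v W - S. (i, j) \<in> E \<longrightarrow> (f(v := c)) i = (f(v := c)) j"
    using cert iso iso' by (auto simp: inertia_certificate_def)
  ultimately show ?thesis
    using cert W by (auto simp: inertia_certificate_def intro: positive_family_insert)
qed

text \<open>
  The pivot at the leaf adds one to \<open>r\<close> or to \<open>s\<close> and keeps \<open>S\<close>.  The leaf joins the component of
  its neighbour \<open>u\<close>, or forms a new one if \<open>u\<close> belongs to \<open>S\<close>.
\<close>

lemma inertia_certificate_leaf_schur:
  fixes a :: "'a \<Rightarrow> 'a \<Rightarrow> real"
  assumes W: "finite W" "v \<notin> W" "u \<in> W" and E: "sym E" "irrefl E"
    and leaf: "\<And>j. j \<in> W \<Longrightarrow> (v, j) \<in> E \<Longrightarrow> j = u"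
    and pat: "\<And>j. j \<in> W \<Longrightarrow> j \<noteq> u \<Longrightarrow> a v j = 0 \<and> a j v = 0"
    and sym: "a u v = a v u" and nz: "a v v \<noteq> 0"
    and cert: "inertia_certificate E W
      (\<lambda>i j. if i = u \<and> j = u then a u u - (a v u)\<^sup>2 / a v v else a i j) S c f r s"
  shows "\<exists>S c f r s. inertia_certificate E (insert v W) a S c f r s"
proof -
  let ?r = "if 0 < a v v then Suc r else r" and ?s = "if 0 < - a v v then Suc s else s"
  have pos: "has_positive_family (insert v W) a ?r"
    using cert positive_family_leaf_schur[where a = a, OF W pat sym nz]
    by (simp add: inertia_certificate_def)
  have eq: "(\<lambda>i j. - (if i = u \<and> j = u then a u u - (a v u)\<^sup>2 / a v v else a i j)) =
      (\<lambda>i j. if i = u \<and> j = u then - a u u - (- a v u)\<^sup>2 / (- a v v) else - a i j)"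
    by (intro ext) auto
  have neg: "has_positive_family (insert v W) (\<lambda>i j. - a i j) ?s"
    using cert pat sym nz unfolding inertia_certificate_def eq
    by (intro positive_family_leaf_schur[OF W]) auto
  have vS: "v \<notin> S" and S: "S \<subseteq> W" using cert W by (auto simp: inertia_certificate_def)
  have *: "insert v W - S = insert v (W - S)" using vS by auto
  have nbr: "j = u" if "j \<in> insert v W" "(v, j) \<in> E \<or> (j, v) \<in> E" for j
    using that leaf E by (metis insert_iff irrefl_def symD)
  show ?thesis
  proof (cases "u \<in> S")
    case True
    have "{..<Suc c} \<subseteq> f(v := c) ` (insert v W - S)"
    proof -
      have "f(v := c) ` (W - S) = f ` (W - S)" using W by (intro image_cong) auto
      thus ?thesis using cert unfolding * by (auto simp: inertia_certificate_def lessThan_Suc)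
    qed
    moreover have "\<forall>i\<in>insert v W - S. \<forall>j\<in>insert v W - S. (i, j) \<in> E \<longrightarrow> (f(v := c)) i = (f(v := c)) j"
      using cert nbr True by (fastforce simp: inertia_certificate_def)
    ultimately have "inertia_certificate E (insert v W) a S (Suc c) (f(v := c)) ?r ?s"
      using cert W S pos neg by (auto simp: inertia_certificate_def)
    thus ?thesis by blast
  next
    case False
    have "{..<c} \<subseteq> f(v := f u) ` (insert v W - S)"
    proof -
      have "f(v := f u) ` (W - S) = f ` (W - S)" using W by (intro image_cong) auto
      thus ?thesis using cert unfolding * by (auto simp: inertia_certificate_def)
    qed
    moreover have "\<forall>i\<in>insert v W - S. \<forall>j\<in>insert v W - S. (i, j) \<in> E \<longrightarrow> (f(v := f u)) i = (f(v := f u)) j"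
      using cert nbr by (fastforce simp: inertia_certificate_def)
    ultimately have "inertia_certificate E (insert v W) a S c (f(v := f u)) ?r ?s"
      using cert W S pos neg nz by (auto simp: inertia_certificate_def)
    thus ?thesis by blast
  qed
qed

text \<open>
  The neighbour \<open>u\<close> joins \<open>S\<close>, so that the leaf \<open>v\<close> becomes a component of its own.  The
  hyperbolic plane adds one to both \<open>r\<close> and \<open>s\<close>, which keeps them at least \<open>card S\<close>; both sides
  of the dimension inequality grow by three.
\<close>

lemma inertia_certificate_leaf_hyperbolic:
  fixes a :: "'a \<Rightarrow> 'a \<Rightarrow> real"
  assumes W: "finite W" "v \<notin> W" "u \<notin> W" "u \<noteq> v" and E: "sym E" "irrefl E"
    and leaf: "\<And>j. j \<in> W \<Longrightarrow> (v, j) \<notin> E"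
    and pat: "\<And>j. j \<in> W \<Longrightarrow> a v j = 0 \<and> a j v = 0"
    and sym: "\<And>j. j \<in> insert v W \<Longrightarrow> a u j = a j u" and zero: "a v v = 0" and nz: "a v u \<noteq> 0"
    and cert: "inertia_certificate E W a S c f r s"
  shows "inertia_certificate E (insert v (insert u W)) a (insert u S) (Suc c) (f(v := c)) (Suc r) (Suc s)"
proof -
  have S: "S \<subseteq> W" "finite S" using cert W finite_subset by (auto simp: inertia_certificate_def)
  have *: "insert v (insert u W) - insert u S = insert v (W - S)" using W S by auto
  have pos: "has_positive_family (insert v (insert u W)) a (Suc r)"
  proof (rule positive_family_leaf_hyperbolic[OF W pat sym zero nz])
    show "has_positive_family W a r" using cert by (simp add: inertia_certificate_def)
  qed
  have neg: "has_positive_family (insert v (insert u W)) (\<lambda>i j. - a i j) (Suc s)"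
  proof (rule positive_family_leaf_hyperbolic[OF W])
    show "- a u j = - a j u" if "j \<in> insert v W" for j using sym[OF that] by simp
    show "has_positive_family W (\<lambda>i j. - a i j) s" using cert by (simp add: inertia_certificate_def)
  qed (use pat zero nz in auto)
  have iso: "(v, j) \<notin> E \<and> (j, v) \<notin> E" if "j \<in> insert v (W - S)" for j
  proof -
    have "(v, j) \<notin> E" using that leaf E(2) by (auto simp: irrefl_def)
    thus ?thesis using E(1) by (meson symD)
  qed
  have "{..<Suc c} \<subseteq> f(v := c) ` insert v (W - S)"
  proof -
    have "f(v := c) ` (W - S) = f ` (W - S)" using W by (intro image_cong) auto
    thus ?thesis using cert by (auto simp: inertia_certificate_def lessThan_Suc)
  qed
  moreover have "\<forall>i\<in>insert v (W - S). \<forall>j\<in>insert v (W - S). (i, j) \<in> E \<longrightarrow> (f(v := c)) i = (f(v := c)) j"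
    using cert iso by (auto simp: inertia_certificate_def)
  moreover have "card (insert u S) = Suc (card S)" using S W by (meson card_insert_disjoint subsetD)
  moreover have "card (insert v (insert u W)) = Suc (Suc (card W))" using W by auto
  ultimately show ?thesis
    unfolding inertia_certificate_def * using cert pos neg S
    by (auto simp: inertia_certificate_def)
qed

text \<open>
  Induction on the number of vertices.  The statement must range over all matrices with the
  given pattern, since pivoting changes a diagonal entry.
\<close>

lemma forest_inertia_certificate:
  fixes a :: "'a \<Rightarrow> 'a \<Rightarrow> real"
  assumes V: "finite V" and E: "sym E" "irrefl E" and acyc: "\<nexists>vs. cycle_list E V vs"
    and sym: "\<And>i j. i \<in> V \<Longrightarrow> j \<in> V \<Longrightarrow> a i j = a j i"
    and pat: "\<And>i j. i \<in> V \<Longrightarrow> j \<in> V \<Longrightarrow> i \<noteq> j \<Longrightarrow> a i j \<noteq> 0 \<longleftrightarrow> (i, j) \<in> E"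
  shows "\<exists>S c f r s. inertia_certificate E V a S c f r s"
  using V acyc sym pat
proof (induction "card V" arbitrary: V a rule: less_induct)
  case (less V a)
  note sym = less.prems(3) and pat = less.prems(4)
  have IH: "\<exists>S c f r s. inertia_certificate E W b S c f r s"
    if WV: "W \<subset> V" and bsym: "\<And>i j. i \<in> W \<Longrightarrow> j \<in> W \<Longrightarrow> b i j = b j i"
      and bpat: "\<And>i j. i \<in> W \<Longrightarrow> j \<in> W \<Longrightarrow> i \<noteq> j \<Longrightarrow> b i j = a i j" for W b
  proof (rule less.hyps)
    show "card W < card V" using WV less.prems(1) by (simp add: psubset_card_mono)
    show "finite W" using WV less.prems(1) by (metis finite_subset psubset_imp_subset)
    show "\<nexists>vs. cycle_list E W vs" using less.prems(2) WV by (auto simp: cycle_list_def)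
    show "b i j = b j i" if "i \<in> W" "j \<in> W" for i j using that by (rule bsym)
    show "b i j \<noteq> 0 \<longleftrightarrow> (i, j) \<in> E" if "i \<in> W" "j \<in> W" "i \<noteq> j" for i j
    proof -
      have "i \<in> V" "j \<in> V" using that WV by auto
      thus ?thesis using bpat[OF that] pat[of i j] that(3) by simp
    qed
  qed
  show ?case
  proof (cases "V = {}")
    case True
    show ?thesis
      by (intro exI[of _ "{}"] exI[of _ 0] exI) (simp add: True inertia_certificate_def has_positive_family_def)
  next
    case False
    then obtain v u where v: "v \<in> V" and u: "\<And>j. j \<in> V \<Longrightarrow> (v, j) \<in> E \<Longrightarrow> j = u"
      using acyclic_imp_leaf[OF less.prems(1) _ E less.prems(2)] by blast
    define W where "W = V - {v}"
    have W: "finite W" "v \<notin> W" and VW: "V = insert v W" and WV: "W \<subset> V"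
      using less.prems(1) v by (auto simp: W_def)
    have vv: "(v, v) \<notin> E" using E(2) by (simp add: irrefl_def)
    show ?thesis
    proof (cases "u \<in> W \<and> (v, u) \<in> E")
      case False
      hence "(v, j) \<notin> E" if "j \<in> insert v W" for j using that u vv VW by blast
      moreover obtain S c f r s where "inertia_certificate E W a S c f r s"
        using IH[OF WV, of a] sym WV by blast
      ultimately show ?thesis
        using inertia_certificate_isolated[OF W E(1)] unfolding VW by blast
    next
      case True
      hence uV: "u \<in> V" "u \<noteq> v" using W VW by auto
      have pat': "a v j = 0 \<and> a j v = 0" if "j \<in> W" "j \<noteq> u" for j
        using that u[of j] pat[of v j] sym[of v j] v W VW by auto
      have suv: "a u v = a v u" using sym v uV by blast
      show ?thesis
      proof (cases "a v v = 0")
        case False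
        define b where "b = (\<lambda>i j. if i = u \<and> j = u then a u u - (a v u)\<^sup>2 / a v v else a i j)"
        have "b i j = b j i" if "i \<in> W" "j \<in> W" for i j
          using that sym WV by (auto simp: b_def)
        moreover have "b i j = a i j" if "i \<noteq> j" for i j using that by (auto simp: b_def)
        ultimately obtain S c f r s where cert: "inertia_certificate E W b S c f r s"
          using IH[OF WV, of b] by blast
        show ?thesis unfolding VW
        proof (rule inertia_certificate_leaf_schur[OF W _ E _ _ suv False cert[unfolded b_def]])
          show "u \<in> W" using True by blast
          show "j = u" if "j \<in> W" "(v, j) \<in> E" for j using that u VW by blast
        qed (fact pat')
      next
        case zero: True
        define X where "X = W - {u}"
        have X: "finite X" "v \<notin> X" "u \<notin> X" "u \<noteq> v" and VX: "V = insert v (insert u X)" and XV: "X \<subset> V"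
          using W uV VW True by (auto simp: X_def)
        obtain S c f r s where cert: "inertia_certificate E X a S c f r s"
          using IH[OF XV, of a] sym XV by blast
        have "inertia_certificate E (insert v (insert u X)) a (insert u S) (Suc c) (f(v := c)) (Suc r) (Suc s)"
        proof (rule inertia_certificate_leaf_hyperbolic[OF X E _ _ _ zero _ cert])
          show "(v, j) \<notin> E" if "j \<in> X" for j using that u[of j] VX X by blast
          show "a v j = 0 \<and> a j v = 0" if "j \<in> X" for j using that pat' by (auto simp: X_def)
          show "a u j = a j u" if "j \<in> insert v X" for j using that sym uV VX by blast
          show "a v u \<noteq> 0" using pat[of v u] True v uV by blast
        qed
        thus ?thesis unfolding VX by blast
      qed
    qed
  qed
qed

section \<open>Forests have elementary inertias only\<close>

lemma cycle_list_imp_cycle: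
  assumes "cycle_list (parcs F) (pverts F) vs"
  shows "\<exists>p. pre_digraph.cycle (with_proj F) p \<and> 3 \<le> length p"
proof -
  have walk: "pcas x (zip (x # xs) (xs @ [w])) w \<and>
      pawalk_verts x (zip (x # xs) (xs @ [w])) = x # xs @ [w]" for x w :: 'a and xs
    by (induction xs arbitrary: x) auto
  have arcs: "set (zip (x # xs) (xs @ [w])) \<subseteq> E"
    if "successively (\<lambda>x y. (x, y) \<in> E) (x # xs)" "(last (x # xs), w) \<in> E" for x w :: 'a and xs E
    using that by (induction xs arbitrary: x) auto
  obtain x xs where vs: "vs = x # xs"
    using assms by (cases vs) (auto simp: cycle_list_def)
  define p where "p = zip (x # xs) (xs @ [x])"
  have "pre_digraph.awalk (with_proj F) x p x"
    using assms walk[of x xs x] arcs[of "parcs F" x xs x]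
    by (simp add: pre_digraph.awalk_def cas_with_proj_eq p_def vs cycle_list_def)
  moreover have "pre_digraph.awalk_verts (with_proj F) x p = x # xs @ [x]"
    using walk[of x xs x] by (simp add: awalk_verts_with_proj_eq p_def)
  moreover have "p \<noteq> []" "3 \<le> length p" "distinct (xs @ [x])"
    using assms by (auto simp: p_def vs cycle_list_def)
  ultimately show ?thesis by (intro exI[of _ p]) (auto simp: pre_digraph.cycle_def)
qed

text \<open>
  A labelling that is constant along arcs is constant on strongly connected components, hence
  each label is attained by a component of its own.
\<close>

lemma num_components_ge:
  assumes H: "fin_digraph H"
    and const: "\<And>u v. u \<rightarrow>\<^bsub>H\<^esub> v \<Longrightarrow> f u = f v"
    and surj: "{..<c} \<subseteq> f ` verts H"
  shows "c \<le> num_components H"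
proof -
  interpret fin_digraph H by (rule H)
  have reach: "f u = f v" if "u \<rightarrow>\<^sup>*\<^bsub>H\<^esub> v" for u v
    using that by (induction rule: converse_reachable_induct) (auto dest: const)
  have "{..<c} \<subseteq> (\<lambda>T. f (SOME x. x \<in> T)) ` sccs_verts"
  proof
    fix l assume "l \<in> {..<c}"
    then obtain w where w: "w \<in> verts H" "f w = l" using surj by blast
    have "(SOME x. x \<in> scc_of w) \<in> scc_of w"
      using in_scc_of_self[OF w(1)] by (rule someI)
    hence "f (SOME x. x \<in> scc_of w) = l" using reach w(2) by (auto simp: scc_of_def)
    thus "l \<in> (\<lambda>T. f (SOME x. x \<in> T)) ` sccs_verts"
      using scc_of_in_sccs_verts[OF w(1)] by (metis image_eqI)
  qed
  hence "card {..<c} \<le> card sccs_verts" by (intro surj_card_le finite_sccs_verts)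
  thus ?thesis by (simp add: num_components_def card_sccs_verts)
qed

lemma finite_num_components_induced:
  assumes G: "fin_digraph G"
  shows "finite {num_components F |F. induced_subgraph F G \<and> P F}"
proof (rule finite_subset)
  interpret fin_digraph G by (rule G)
  show "finite ((\<lambda>W. num_components (G \<restriction> W)) ` Pow (verts G))" by simp
  show "{num_components F |F. induced_subgraph F G \<and> P F} \<subseteq>
      (\<lambda>W. num_components (G \<restriction> W)) ` Pow (verts G)"
  proof
    fix c assume "c \<in> {num_components F |F. induced_subgraph F G \<and> P F}"
    then obtain F where F: "c = num_components F" "induced_subgraph F G" by blast
    have "verts F \<subseteq> verts G" using F(2) by auto
    thus "c \<in> (\<lambda>W. num_components (G \<restriction> W)) ` Pow (verts G)"
      using F induce_eq_iff_induced[OF F(2)] by (metis PowI image_eqI)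
  qed
qed

lemma max_disconnection_ge:
  assumes G: "pair_graph G" and S: "S \<subseteq> pverts G" "card S = k"
    and const: "\<And>i j. i \<in> pverts G - S \<Longrightarrow> j \<in> pverts G - S \<Longrightarrow> (i, j) \<in> parcs G \<Longrightarrow> f i = f j"
    and surj: "{..<c} \<subseteq> f ` (pverts G - S)"
  shows "c \<le> max_disconnection k G"
proof -
  interpret pair_graph G by (rule G)
  have fin: "fin_digraph (with_proj G)" by unfold_locales
  define H where "H = with_proj G \<restriction> (pverts G - S)"
  have ind: "induced_subgraph H (with_proj G)"
    unfolding H_def by (rule induced_induce) auto
  have "fin_digraph H"
    using fin ind by (meson fin_digraph.fin_digraph_subgraph induced_imp_subgraph)
  hence "c \<le> num_components H"
  proof (rule num_components_ge)
    show "f u = f v" if "u \<rightarrow>\<^bsub>H\<^esub> v" for u v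
      using that const by (auto simp: H_def arcs_ends_conv)
    show "{..<c} \<subseteq> f ` verts H" using surj by (simp add: H_def)
  qed
  also have "card (verts H) = card (pverts G) - k"
    using S by (simp add: H_def card_Diff_subset finite_subset)
  hence "num_components H \<le> max_disconnection k G"
    unfolding max_disconnection_def
    using ind by (intro Max_ge finite_num_components_induced fin) auto
  finally show ?thesis .
qed

lemma max_disconnection_0:
  assumes G: "pair_graph G"
  shows "max_disconnection 0 G = num_components (with_proj G)"
proof -
  interpret pair_graph G by (rule G)
  have self: "induced_subgraph (with_proj G) (with_proj G)"
    using wf_digraph_axioms in_arcsD1 in_arcsD2
    by (auto simp: induced_subgraph_def subgraph_def compatible_def)
  have "F = with_proj G" if "induced_subgraph F (with_proj G)" "card (verts F) = card (pverts G)" for F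
  proof (rule induced_eq_verts_imp_eq[OF that(1) self])
    have "verts F \<subseteq> pverts G" using that(1) by (simp add: induced_subgraph_def subgraph_def)
    thus "verts F = verts (with_proj G)"
      using card_subset_eq[OF pair_finite_verts] that(2) by simp
  qed
  hence "{num_components F |F. induced_subgraph F (with_proj G) \<and> card (verts F) = card (pverts G) - 0} =
      {num_components (with_proj G)}" using self by auto
  thus ?thesis unfolding max_disconnection_def by simp
qed

lemma sym_matsD:
  assumes "graph_on n G" "A \<in> sym_mats G"
  shows "A \<in> carrier_mat n n" "transpose_mat A = A"
    "\<And>i j. i < n \<Longrightarrow> j < n \<Longrightarrow> i \<noteq> j \<Longrightarrow> A $$ (i, j) \<noteq> 0 \<longleftrightarrow> (i, j) \<in> parcs G"
proof -
  have n: "card (pverts G) = n" using assms(1) by (simp add: graph_on_def)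
  note * = assms(2)[unfolded sym_mats_def Let_def n mem_Collect_eq]
  show "A \<in> carrier_mat n n" using * by (rule conjunct1)
  show "transpose_mat A = A" using * by (elim conjE)
  show "A $$ (i, j) \<noteq> 0 \<longleftrightarrow> (i, j) \<in> parcs G" if "i < n" "j < n" "i \<noteq> j" for i j
    using conjunct2[OF conjunct2[OF *]] that by (elim allE impE)
qed

lemma graph_arcs_sym_irrefl:
  assumes "pair_graph G"
  shows "sym (parcs G)" "irrefl (parcs G)"
proof -
  interpret pair_graph G by (rule assms)
  show "sym (parcs G)" by (rule symI) (rule arcs_symmetric)
  show "irrefl (parcs G)" using no_loops' by (auto simp: irrefl_def)
qed

lemma forest_inertia_elementary:
  assumes G: "graph_on n F" and forest: "undirected_forest F" and A: "A \<in> sym_mats F"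
  shows "elementary_inertia F (pin A)"
proof -
  note Am = sym_matsD[OF G A]
  have pg: "pair_graph F" and V: "pverts F = {..<n}"
    using G by (simp_all add: graph_on_def atLeast0LessThan)
  have acyc: "\<nexists>vs. cycle_list (parcs F) {..<n} vs"
    using cycle_list_imp_cycle[of F] forest unfolding V undirected_forest_def by blast
  have "\<exists>S c f r s. inertia_certificate (parcs F) {..<n} (\<lambda>i j. A $$ (i, j)) S c f r s"
    by (rule forest_inertia_certificate[OF _ graph_arcs_sym_irrefl[OF pg] acyc])
       (use Am(3) symmetric_mat_index[OF Am(1,2)] in simp_all)
  then obtain S c f r s where cert:
    "inertia_certificate (parcs F) {..<n} (\<lambda>i j. A $$ (i, j)) S c f r s" by blast
  have "r \<le> num_pos_eigenvalues A" "s \<le> num_neg_eigenvalues A"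
    using cert positive_family_le_num_pos_eigenvalues[OF Am(1,2)]
      negative_family_le_num_neg_eigenvalues[OF Am(1,2)] by (auto simp: inertia_certificate_def)
  moreover have "c \<le> max_disconnection (card S) F"
    using cert V by (intro max_disconnection_ge[OF pg, where f = f]) (auto simp: inertia_certificate_def)
  moreover have "card S \<le> n"
    using cert card_mono[of "{..<n}" S] by (auto simp: inertia_certificate_def)
  ultimately show ?thesis
    using cert num_pos_plus_num_neg_le[OF Am(1,2)] V
    by (auto simp: elementary_inertia_def pin_def Let_def inertia_certificate_def intro!: exI[of _ "card S"])
qed

section \<open>A positive semidefinite matrix with large kernel on a cycle\<close>

lemma pcas_end_in_verts: "pcas a q b \<Longrightarrow> b \<in> set (pawalk_verts a q)"
  by (induction q arbitrary: a) auto

lemma path_does_not_leave_end: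
  "pcas a q b \<Longrightarrow> distinct (pawalk_verts a q) \<Longrightarrow> (b, x) \<notin> set q"
  by (induction q arbitrary: a) (auto dest: pcas_end_in_verts)

lemma fst_in_pawalk_verts: "(x, y) \<in> set q \<Longrightarrow> x \<in> set (pawalk_verts a q)"
  by (induction q arbitrary: a) auto

lemma pcas_imp_rtrancl: "pcas a q b \<Longrightarrow> set q \<subseteq> E \<Longrightarrow> (a, b) \<in> E\<^sup>*"
  by (induction q arbitrary: a) (auto intro: converse_rtrancl_into_rtrancl)

text \<open>
  Going round the cycle the other way.  The remaining walk \<open>q\<close> from \<open>w\<close> to \<open>u\<close> visits each vertex
  once, so it does not leave its end \<open>u\<close>; and it can use the arc from \<open>w\<close> to \<open>u\<close> only as its first
  and only arc, which the length of the cycle excludes.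
\<close>

lemma cycle_imp_non_bridge:
  assumes cyc: "pre_digraph.cycle (with_proj G) p" and len: "3 \<le> length p"
  obtains u w where "(u, w) \<in> parcs G" "(w, u) \<in> (parcs G - {(u, w), (w, u)})\<^sup>*"
proof -
  obtain u where u: "set p \<subseteq> parcs G" "pcas u p u" "distinct (tl (pawalk_verts u p))"
    using cyc by (auto simp: pre_digraph.cycle_def pre_digraph.awalk_def
        cas_with_proj_eq awalk_verts_with_proj_eq)
  obtain w q where p: "p = (u, w) # q" using u(2) len by (cases p) auto
  have q: "pcas w q u" "distinct (pawalk_verts w q)" "set q \<subseteq> parcs G" "(u, w) \<in> parcs G"
    using u by (auto simp: p)
  obtain c q' where q': "q = (w, c) # q'" using q(1) len by (cases q) (auto simp: p)
  have "(w, u) \<notin> set q'"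
    using q(2) fst_in_pawalk_verts[of w u q' c] by (auto simp: q')
  moreover have "c \<noteq> u"
  proof
    assume "c = u"
    moreover obtain d q'' where "q' = (c, d) # q''"
      using q(1) len by (cases q') (auto simp: p q')
    ultimately show False using path_does_not_leave_end[of u q' u d] q(1,2) by (auto simp: q')
  qed
  ultimately have "(w, u) \<notin> set q" by (auto simp: q')
  moreover have "(u, w) \<notin> set q" using path_does_not_leave_end[OF q(1,2)] .
  ultimately have "set q \<subseteq> parcs G - {(u, w), (w, u)}" using q(3) by auto
  from pcas_imp_rtrancl[OF q(1) this] q(4) show ?thesis by (rule that[rotated])
qed

definition laplacian :: "nat \<Rightarrow> (nat \<times> nat) set \<Rightarrow> nat \<Rightarrow> nat \<Rightarrow> real" where
  "laplacian n E i j =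
     (if i = j then \<Sum>k<n. of_bool ((i, k) \<in> E) else 0) - of_bool ((i, j) \<in> E)"

lemma laplacian_apply:
  assumes "i < n"
  shows "(\<Sum>j<n. laplacian n E i j * x j) = (\<Sum>j<n. of_bool ((i, j) \<in> E) * (x i - x j))"
proof -
  have "(\<Sum>j<n. laplacian n E i j * x j) =
      (\<Sum>j<n. (if i = j then (\<Sum>k<n. of_bool ((i, k) \<in> E)) * x j else 0)) - (\<Sum>j<n. of_bool ((i, j) \<in> E) * x j)"
    unfolding laplacian_def sum_subtractf[symmetric]
    by (intro sum.cong refl) (auto simp: left_diff_distrib)
  also have "\<dots> = (\<Sum>j<n. of_bool ((i, j) \<in> E) * (x i - x j))"
    using assms by (simp add: right_diff_distrib sum_subtractf sum_distrib_right)
  finally show ?thesis .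
qed

lemma bform_eq_sum_apply:
  "bform {..<n} a x y = (\<Sum>i<n. x i * (\<Sum>j<n. a i j * y j))"
  by (simp add: bform_def sum_distrib_left mult_ac)

text \<open>
  The sum runs over ordered pairs, hence counts each edge twice.
\<close>

lemma bform_laplacian:
  assumes "sym E"
  shows "2 * bform {..<n} (laplacian n E) x y =
    (\<Sum>i<n. \<Sum>j<n. of_bool ((i, j) \<in> E) * ((x i - x j) * (y i - y j)))"
proof -
  have E: "(j, i) \<in> E \<longleftrightarrow> (i, j) \<in> E" for i j using assms by (auto dest: symD)
  have 1: "bform {..<n} (laplacian n E) x y = (\<Sum>i<n. \<Sum>j<n. of_bool ((i, j) \<in> E) * (x i * (y i - y j)))"
    unfolding bform_eq_sum_apply
    by (intro sum.cong refl) (simp add: laplacian_apply, simp add: sum_distrib_left mult_ac)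
  also have "\<dots> = (\<Sum>i<n. \<Sum>j<n. of_bool ((i, j) \<in> E) * (x j * (y j - y i)))"
    by (subst sum.swap) (simp add: E)
  finally have "2 * bform {..<n} (laplacian n E) x y =
     (\<Sum>i<n. \<Sum>j<n. of_bool ((i, j) \<in> E) * (x i * (y i - y j))) +
     (\<Sum>i<n. \<Sum>j<n. of_bool ((i, j) \<in> E) * (x j * (y j - y i)))" using 1 by simp
  also have "\<dots> = (\<Sum>i<n. \<Sum>j<n. of_bool ((i, j) \<in> E) * ((x i - x j) * (y i - y j)))"
    unfolding sum.distrib[symmetric] by (intro sum.cong refl) (simp add: algebra_simps)
  finally show ?thesis .
qed

lemma bform_laplacian_nonneg:
  assumes "sym E"
  shows "0 \<le> bform {..<n} (laplacian n E) x x"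
proof -
  have "0 \<le> (\<Sum>i<n. \<Sum>j<n. of_bool ((i, j) \<in> E) * ((x i - x j) * (x i - x j)))"
    by (intro sum_nonneg) auto
  thus ?thesis using bform_laplacian[OF assms, of n x x] by simp
qed

lemma bform_laplacian_eq_0_imp_constant:
  assumes E: "sym E" "E \<subseteq> {..<n} \<times> {..<n}" and zero: "bform {..<n} (laplacian n E) x x = 0"
    and walk: "(i, j) \<in> E\<^sup>*"
  shows "x i = x j"
  using walk
proof (induction rule: rtrancl_induct)
  case (step j k)
  have j: "j < n" "k < n" using step E by auto
  let ?t = "\<lambda>i j. of_bool ((i, j) \<in> E) * ((x i - x j) * (x i - x j))"
  have nn: "0 \<le> ?t i j" for i j by auto
  have "(\<Sum>i<n. \<Sum>j<n. ?t i j) = 0" using bform_laplacian[OF E(1), of n x x] zero by simp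
  hence "(\<Sum>k<n. ?t j k) = 0"
    using j nn by (subst (asm) sum_nonneg_eq_0_iff) (auto intro!: sum_nonneg)
  hence "?t j k = 0"
    using j nn by (subst (asm) sum_nonneg_eq_0_iff) auto
  thus ?case using step by simp
qed simp

lemma bform_diff_scaled:
  "bform V a (\<lambda>i. x i - t * y i) (\<lambda>i. x i - t * y i) =
     bform V a x x - t * bform V a x y - t * bform V a y x + t\<^sup>2 * bform V a y y"
proof -
  have "a i j * (x i - t * y i) * (x j - t * y j) =
      a i j * x i * x j - t * (a i j * x i * y j) - t * (a i j * y i * x j) + t\<^sup>2 * (a i j * y i * y j)"
    for i j by (simp add: algebra_simps power2_eq_square)
  thus ?thesis
    by (simp add: bform_def sum.distrib sum_subtractf sum_distrib_left)
qed

lemma sccs_verts_closed_under_arcs: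
  assumes G: "pair_graph G" and T: "T \<in> pre_digraph.sccs_verts (with_proj G)" and ij: "(i, j) \<in> parcs G"
  shows "i \<in> T \<longleftrightarrow> j \<in> T"
proof -
  interpret pair_graph G by (rule G)
  have "i \<rightarrow>\<^sup>*\<^bsub>with_proj G\<^esub> j" "j \<rightarrow>\<^sup>*\<^bsub>with_proj G\<^esub> i"
    using ij arcs_symmetric[OF ij] by (auto intro: reachable_adjI)
  thus ?thesis using T unfolding in_sccs_verts_conv_reachable by blast
qed

text \<open>
  Let \<open>L\<close> be the Laplacian of the graph without the edge \<open>uw\<close>, and \<open>b\<close> the difference of the unit
  vectors at \<open>u\<close> and \<open>w\<close>.  Kernel vectors of \<open>L\<close> are constant along the walk from \<open>w\<close> to \<open>u\<close> and
  so orthogonal to \<open>b\<close>; therefore \<open>b = L y\<close> for some \<open>y\<close>.  With \<open>s = b \<bullet> y\<close>, the matrix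
  \<open>A = L - b b\<^sup>T / s\<close> gives the edge \<open>uw\<close> the entry \<open>1 / s\<close> and so has the pattern of the graph.
  It is the edge of negative weight that is as heavy as semidefiniteness permits: by
  Cauchy-Schwarz for \<open>L\<close> the form of \<open>A\<close> is nonnegative, and its kernel contains \<open>y\<close> besides the
  indicator vectors of the components.
\<close>

lemma non_bridge_psd_matrix:
  assumes G: "graph_on n G" and uw: "(u, w) \<in> parcs G"
    and walk: "(w, u) \<in> (parcs G - {(u, w), (w, u)})\<^sup>*"
  obtains A where "A \<in> sym_mats G" "num_neg_eigenvalues A = 0"
    "num_pos_eigenvalues A + num_components (with_proj G) < n"
proof -
  have pg: "pair_graph G" and V: "pverts G = {..<n}"
    using G by (simp_all add: graph_on_def atLeast0LessThan)
  interpret pair_graph G by (rule pg)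
  define E where "E = parcs G - {(u, w), (w, u)}"
  have symE: "sym E" using graph_arcs_sym_irrefl(1)[OF pg] unfolding E_def sym_def by blast
  have EV: "E \<subseteq> {..<n} \<times> {..<n}" using in_arcsD1 in_arcsD2 by (auto simp: E_def V)
  have uwn: "u < n" "w < n" "u \<noteq> w"
    using in_arcsD1[OF uw] in_arcsD2[OF uw] no_loops'[OF uw] unfolding V by simp_all
  have nE: "(u, w) \<notin> E" "(w, u) \<notin> E" "\<And>i. (i, i) \<notin> E"
    using no_loops' by (auto simp: E_def)
  have arc: "(i, j) \<in> parcs G \<longleftrightarrow> (i, j) \<in> E \<or> (i = u \<and> j = w) \<or> (i = w \<and> j = u)" for i j
    using uw arcs_symmetric[OF uw] by (auto simp: E_def)
  define b where "b i = (of_bool (i = u) - of_bool (i = w) :: real)" for i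
  have b_sum: "(\<Sum>i<n. b i * x i) = x u - x w" for x
    using uwn by (simp add: b_def left_diff_distrib sum_subtractf)
  let ?L = "laplacian n E"
  have Lsym: "?L i j = ?L j i" for i j using symE by (auto simp: laplacian_def dest: symD)
  have "x u = x w" if "\<And>i. i < n \<Longrightarrow> (\<Sum>j<n. ?L i j * x j) = 0" for x
    using bform_laplacian_eq_0_imp_constant[OF symE EV _ walk[folded E_def], of x]
    by (simp add: bform_eq_sum_apply that)
  then obtain y where y: "\<And>i. i < n \<Longrightarrow> (\<Sum>j<n. ?L i j * y j) = b i"
    using symmetric_system_solvable[of n ?L b, OF Lsym] by (auto simp: b_sum)
  define s where "s = y u - y w"
  have Ly: "bform {..<n} ?L x y = x u - x w" for x
  proof -
    have "bform {..<n} ?L x y = (\<Sum>i<n. x i * b i)"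
      unfolding bform_eq_sum_apply by (intro sum.cong refl) (simp add: y)
    thus ?thesis using b_sum[of x] by (simp add: mult.commute)
  qed
  have Ly': "bform {..<n} ?L y x = x u - x w" for x
  proof -
    have "bform {..<n} ?L y x = bform {..<n} ?L x y"
      unfolding bform_def by (subst sum.swap) (simp add: Lsym mult_ac)
    thus ?thesis by (simp add: Ly)
  qed
  have "s \<noteq> 0"
  proof
    assume "s = 0"
    hence "y u = y j" if "(u, j) \<in> E" for j
      using bform_laplacian_eq_0_imp_constant[OF symE EV _ r_into_rtrancl[OF that], of y]
      by (simp add: Ly s_def)
    hence "b u = 0" using y[OF uwn(1)] laplacian_apply[OF uwn(1), of E y] by (simp add: sum.neutral)
    thus False using uwn by (simp add: b_def)
  qed
  moreover have "0 \<le> s" using bform_laplacian_nonneg[OF symE, of n y] by (simp add: Ly s_def)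
  ultimately have s: "0 < s" by simp
  define A where "A = mat n n (\<lambda>(i, j). ?L i j - b i * b j / s)"
  have Aij: "A $$ (i, j) = ?L i j - b i * b j / s" if "i < n" "j < n" for i j
    using that by (simp add: A_def)
  have Ac: "A \<in> carrier_mat n n" by (simp add: A_def)
  have At: "transpose_mat A = A"
    by (rule eq_matI) (auto simp: A_def Lsym mult.commute)
  have Apat: "A $$ (i, j) \<noteq> 0 \<longleftrightarrow> (i, j) \<in> parcs G" if "i < n" "j < n" "i \<noteq> j" for i j
    unfolding Aij[OF that(1,2)] arc using that(3) s nE uwn(3)
    by (auto simp: laplacian_def b_def)
  have AS: "A \<in> sym_mats G"
    unfolding sym_mats_def Let_def V card_lessThan using Ac At Apat by simp
  have Aapp: "(\<Sum>j<n. A $$ (i, j) * x j) = (\<Sum>j<n. ?L i j * x j) - b i * (x u - x w) / s"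
    if "i < n" for i x
  proof -
    have "(\<Sum>j<n. A $$ (i, j) * x j) = (\<Sum>j<n. ?L i j * x j - b i / s * (b j * x j))"
      using that by (intro sum.cong refl) (simp add: Aij algebra_simps)
    thus ?thesis by (simp only: sum_subtractf sum_distrib_left[symmetric] b_sum) simp
  qed
  have psd: "0 \<le> bform {..<n} (\<lambda>i j. A $$ (i, j)) x x" for x
  proof -
    let ?t = "(x u - x w) / s"
    \<comment> \<open>The step of the Cauchy-Schwarz inequality: \<open>?t\<close> minimizes the form of \<open>L\<close> on \<open>x - t y\<close>.\<close>
    have "bform {..<n} (\<lambda>i j. A $$ (i, j)) x x =
        (\<Sum>i<n. x i * (\<Sum>j<n. ?L i j * x j) - b i * x i * ?t)"
      unfolding bform_eq_sum_apply by (intro sum.cong refl) (simp add: Aapp right_diff_distrib)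
    also have "\<dots> = bform {..<n} ?L x x - (x u - x w) * ?t"
      by (simp only: sum_subtractf bform_eq_sum_apply sum_distrib_right[symmetric] b_sum)
    also have "\<dots> = bform {..<n} ?L (\<lambda>i. x i - ?t * y i) (\<lambda>i. x i - ?t * y i)"
      unfolding bform_diff_scaled using s
      by (simp add: Ly Ly' flip: s_def) (simp add: field_simps power2_eq_square)
    also have "\<dots> \<ge> 0" by (rule bform_laplacian_nonneg[OF symE])
    finally show ?thesis .
  qed
  define I where "I = insert None (Some ` sccs_verts)"
  define F :: "nat set option \<Rightarrow> nat \<Rightarrow> real"
    where "F = case_option y (\<lambda>T j. of_bool (j \<in> T))"
  have F: "F None = y" "\<And>T. F (Some T) = (\<lambda>j. of_bool (j \<in> T))" by (simp_all add: F_def)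
  have closed: "i \<in> T \<longleftrightarrow> j \<in> T" if "T \<in> sccs_verts" "(i, j) \<in> parcs G" for T i j
    using sccs_verts_closed_under_arcs[OF pg that] .
  have finI: "finite I" by (simp add: I_def finite_sccs_verts)
  have ker: "(\<Sum>j<n. A $$ (i, j) * F t j) = 0" if t: "t \<in> I" and i: "i < n" for t i
  proof (cases t)
    case None
    thus ?thesis using s by (simp add: F Aapp[OF i] y[OF i] flip: s_def)
  next
    case (Some T)
    hence T: "T \<in> sccs_verts" using t by (auto simp: I_def)
    have "(\<Sum>j<n. ?L i j * of_bool (j \<in> T)) = 0"
      unfolding laplacian_apply[OF i] using closed[OF T] arc by (intro sum.neutral) auto
    thus ?thesis using closed[OF T uw] by (simp add: Some F Aapp[OF i])
  qed
  have indep: "\<forall>t\<in>I. c t = 0" if c: "\<And>j. j < n \<Longrightarrow> (\<Sum>t\<in>I. c t * F t j) = 0" for c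
  proof -
    have split: "(\<Sum>t\<in>I. c t * F t j) = c None * y j + (\<Sum>T\<in>sccs_verts. c (Some T) * of_bool (j \<in> T))" for j
      by (simp add: I_def F sum.reindex finite_sccs_verts image_iff)
    \<comment> \<open>The components do not separate \<open>u\<close> and \<open>w\<close>, but \<open>y\<close> does.\<close>
    have "(\<Sum>T\<in>sccs_verts. c (Some T) * of_bool (u \<in> T)) = (\<Sum>T\<in>sccs_verts. c (Some T) * of_bool (w \<in> T))"
      using closed[OF _ uw] by (intro sum.cong refl) simp
    hence "c None * s = 0"
      using c[OF uwn(1)] c[OF uwn(2)] unfolding split s_def right_diff_distrib by linarith
    hence None: "c None = 0" using s by simp
    have "c (Some T) = 0" if T: "T \<in> sccs_verts" for T
    proof -
      obtain j where j: "j \<in> T" using T by (auto simp: in_sccs_verts_conv_reachable)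
      have "j < n" using sccs_verts_subsets[OF T] j V by auto
      have "(\<Sum>T'\<in>sccs_verts. c (Some T') * of_bool (j \<in> T')) =
          (\<Sum>T'\<in>sccs_verts. if T' = T then c (Some T) else 0)"
        using sccs_verts_disjoint[OF T] j by (intro sum.cong refl) auto
      thus ?thesis
        using c[OF \<open>j < n\<close>] T None unfolding split by (simp add: finite_sccs_verts)
    qed
    thus ?thesis using None by (auto simp: I_def)
  qed
  have "card I = Suc (num_components (with_proj G))"
    by (simp add: I_def finite_sccs_verts card_image num_components_def card_sccs_verts image_iff)
  moreover have "num_neg_eigenvalues A = 0"
    using Ac At psd finI ker indep by (rule positive_semidefinite_inertia(1))
  moreover have "num_pos_eigenvalues A + card I \<le> n"
    using Ac At psd finI ker indep by (rule positive_semidefinite_inertia(2))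
  ultimately show ?thesis using that[OF AS] by simp
qed

text \<open>
  With no negative eigenvalue, an elementary inertia must use \<open>k = 0\<close>, which forces the rank to
  be at least the number of vertices minus the number of components.  The matrix built on a
  cycle has smaller rank.
\<close>

lemma all_inertias_elementary_imp_forest:
  assumes G: "graph_on n G" and elem: "\<forall>A\<in>sym_mats G. elementary_inertia G (pin A)"
  shows "undirected_forest G"
proof (rule ccontr)
  assume "\<not> undirected_forest G"
  moreover have pg: "pair_graph G" and V: "pverts G = {..<n}"
    using G by (simp_all add: graph_on_def atLeast0LessThan)
  ultimately obtain p where "pre_digraph.cycle (with_proj G) p" "3 \<le> length p"
    unfolding undirected_forest_def by blast
  then obtain u w where "(u, w) \<in> parcs G" "(w, u) \<in> (parcs G - {(u, w), (w, u)})\<^sup>*"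
    by (rule cycle_imp_non_bridge)
  then obtain A where A: "A \<in> sym_mats G" "num_neg_eigenvalues A = 0"
      "num_pos_eigenvalues A + num_components (with_proj G) < n"
    by (rule non_bridge_psd_matrix[OF G])
  have "elementary_inertia G (pin A)" using elem A(1) by (rule bspec)
  then obtain k where "int k \<le> int (num_neg_eigenvalues A)"
      "int n - int (max_disconnection k G) + int k
        \<le> int (num_pos_eigenvalues A) + int (num_neg_eigenvalues A)"
    unfolding elementary_inertia_def pin_def Let_def V by auto
  thus False using A(2,3) max_disconnection_0[OF pg] by auto
qed

theorem theorem1p1:
  shows "(\<forall>n F. graph_on n F \<and> undirected_forest F \<longrightarrow>
            (\<forall>A\<in>sym_mats F. \<forall>r s. pin A = (r, s) \<longrightarrow> elementary_inertia F (r, s))) \<and>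
         (\<forall>n G. graph_on n G \<and> (\<forall>A\<in>sym_mats G. elementary_inertia G (pin A)) \<longrightarrow>
            undirected_forest G)"
proof (intro conjI allI impI ballI)
  fix n F A r s
  assume "graph_on n F \<and> undirected_forest F" "A \<in> sym_mats F" "pin A = (r, s)"
  thus "elementary_inertia F (r, s)" using forest_inertia_elementary[of n F A] by simp
next
  fix n G
  assume "graph_on n G \<and> (\<forall>A\<in>sym_mats G. elementary_inertia G (pin A))"
  thus "undirected_forest G" using all_inertias_elementary_imp_forest[of n G] by blast
qed

end
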